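(* Let $q$ be a prime power and $n\geq 1$ a divisor of $q-1$ such that $q(q-1)/n$ is even. Suppose that a cyclic group of order $n$ has a difference set (possibly, trivial) with parameters $(n,k,\lambda)$. Then there exists a divisible design graph with parameters $$\left(n(q+1),\; kq,\; \lambda q,\; \frac{k^2(q-1)}{n},\; q+1,\; n\right).$$
   Context: A divisible design graph with parameters $(v,k,\lambda_1,\lambda_2,m,n)$ is a $k$-regular (simple undirected) graph on $v$ vertices whose vertex set can be partitioned into $m$ classes of size $n$ such that any two distinct vertices from the same class have exactly $\lambda_1$ common neighbors and any two vertices from different classes have exactly $\lambda_2$ common neighbors. A nonempty subset $D$ of a finite group $G$ is a difference set with parameters $(|G|,k,\lambda)$, where $k=|D|$ and $\lambda$ is a nonnegative integer, if every nonidentity element of $G$ has exactly $\lambda$ representations in the form $g_1g_2^{-1}$ with $g_1,g_2\in D$. It is nontrivial if $2\le |D|\le |G|-2$ and trivial otherwise. *)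

theory Defs
  imports
    "HOL-Algebra.Elementary_Groups"
    "HOL-Number_Theory.Prime_Powers"
    "HOL-Library.Disjoint_Sets"
    "Graph_Theory.Pair_Digraph"
begin

(* Finite simple undirected graphs are the library's pair_graph: finite, loop-free,
   and an undirected edge is stored as two arcs in opposite directions. *)

definition neighbors :: "'a pair_pre_digraph \<Rightarrow> 'a \<Rightarrow> 'a set" where
  "neighbors \<Gamma> x = {y. (x, y) \<in> parcs \<Gamma>}"

definition common_neighbors :: "'a pair_pre_digraph \<Rightarrow> 'a \<Rightarrow> 'a \<Rightarrow> 'a set" where
  "common_neighbors \<Gamma> x y = neighbors \<Gamma> x \<inter> neighbors \<Gamma> y"

definition divisible_design_graph ::
  "'a pair_pre_digraph \<Rightarrow> nat \<Rightarrow> nat \<Rightarrow> nat \<Rightarrow> nat \<Rightarrow> nat \<Rightarrow> nat \<Rightarrow> bool" where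
  "divisible_design_graph \<Gamma> v k l\<^sub>1 l\<^sub>2 m n \<longleftrightarrow>
     pair_graph \<Gamma> \<and>
     card (pverts \<Gamma>) = v \<and>
     (\<forall>x\<in>pverts \<Gamma>. card (neighbors \<Gamma> x) = k) \<and>
     (\<exists>P. partition_on (pverts \<Gamma>) P \<and> card P = m \<and> (\<forall>C\<in>P. card C = n) \<and>
        (\<forall>C\<in>P. \<forall>x\<in>C. \<forall>y\<in>C. x \<noteq> y \<longrightarrow> card (common_neighbors \<Gamma> x y) = l\<^sub>1) \<and>
        (\<forall>C\<in>P. \<forall>C'\<in>P. C \<noteq> C' \<longrightarrow>
           (\<forall>x\<in>C. \<forall>y\<in>C'. card (common_neighbors \<Gamma> x y) = l\<^sub>2)))"

(* Trivial difference sets are included. In particular, over the group of order 1 the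
   last conjunct is vacuous, so there every l is admissible. *)
definition difference_set ::
  "('a, 'b) monoid_scheme \<Rightarrow> 'a set \<Rightarrow> nat \<Rightarrow> nat \<Rightarrow> nat \<Rightarrow> bool" where
  "difference_set G D v k l \<longleftrightarrow>
     finite (carrier G) \<and> order G = v \<and>
     D \<subseteq> carrier G \<and> D \<noteq> {} \<and> card D = k \<and>
     (\<forall>g\<in>carrier G - {\<one>\<^bsub>G\<^esub>}.
        card {(g\<^sub>1, g\<^sub>2). g\<^sub>1 \<in> D \<and> g\<^sub>2 \<in> D \<and> g = g\<^sub>1 \<otimes>\<^bsub>G\<^esub> inv\<^bsub>G\<^esub> g\<^sub>2} = l)"

end

theory Submission
  imports
    "HOL-Computational_Algebra.Polynomial"
    "HOL-Number_Theory.Residues"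
    "HOL-Algebra.QuotRing"
    "HOL-Algebra.Multiplicative_Group"
    Defs
begin

text \<open>
  Let \<open>F\<close> be the field with \<open>q\<close> elements. The multiplicative group of \<open>F\<close> is cyclic of order \<open>q - 1\<close>, so
  it has a homomorphism \<open>\<chi>\<close> onto the cyclic group \<open>G\<close> of order \<open>n\<close>. The vertices of the graph
  are the pairs \<open>(x, g)\<close> of a point of the projective line over \<open>F\<close> and an element of \<open>G\<close>, with one class
  of size \<open>n\<close> for each of the \<open>q + 1\<close> points; they may be thought of as the nonzero
  vectors of the plane modulo the kernel of \<open>\<chi>\<close>. Two vertices \<open>(x, g)\<close> and \<open>(y, h)\<close> with
  \<open>x \<noteq> y\<close> are adjacent if \<open>\<chi> (det (x, y)) \<otimes> g \<otimes> h\<close> lies in the difference set \<open>D\<close>, that is, if the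
  determinant of the two vectors has its image in \<open>D\<close>.

  The determinant is alternating, so this relation is symmetric if \<open>\<chi> (-1) = 1\<close>; the parity hypothesis
  ensures it (\<open>hom_involution_eq_one\<close>). For points \<open>x \<noteq> y\<close>, the quotient of \<open>det (x, z)\<close> and \<open>det (y, z)\<close>
  runs through all nonzero field elements as \<open>z\<close> runs through the other points, so each element of
  \<open>G\<close> occurs \<open>(q - 1) div n\<close> times as quotient of the weights: the weights form a
  balanced generalized weighing matrix (\<open>balanced_det_weight\<close>). From any such matrix and any difference
  set one obtains a divisible design graph by counting
  (\<open>divisible_design_weighing_graph\<close>): vertices of the same class have \<open>l\<close> common neighbours in each
  of the \<open>q\<close> other classes, and vertices of different classes have \<open>(q - 1) div n\<close> common neighbours
  for each of the \<open>k\<^sup>2\<close> pairs of elements of \<open>D\<close>.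

  The field \<open>F\<close> is constructed as a residue field of \<open>\<int>[\<zeta>]\<close> for a primitive complex root of unity \<open>\<zeta>\<close> of
  order \<open>q - 1\<close> (\<open>finite_field_exists\<close>). The powers of \<open>\<zeta>\<close> and \<open>0\<close> then represent its elements, which
  gives the number of elements directly.
\<close>

section \<open>Divisible design graphs from balanced weighing matrices\<close>

text \<open>
  The construction produces vertices in a product type; an injection of the finite vertex set
  into the natural numbers transports the graph, its classes and all neighbour counts.
\<close>

lemma divisible_design_graph_on_nat:
  fixes \<Gamma> :: "'v pair_pre_digraph"
  assumes "divisible_design_graph \<Gamma> v k l\<^sub>1 l\<^sub>2 m n"
  shows "\<exists>\<Gamma>' :: nat pair_pre_digraph. divisible_design_graph \<Gamma>' v k l\<^sub>1 l\<^sub>2 m n"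
proof -
  let ?V = "pverts \<Gamma>" and ?A = "parcs \<Gamma>"
  from assms have "pair_graph \<Gamma>" and card_V: "card ?V = v"
    and deg: "\<And>x. x \<in> ?V \<Longrightarrow> card (neighbors \<Gamma> x) = k"
    by (simp_all add: divisible_design_graph_def)
  from assms obtain P where part: "partition_on ?V P" and "card P = m"
    and card_C: "\<forall>C\<in>P. card C = n"
    and same: "\<forall>C\<in>P. \<forall>x\<in>C. \<forall>y\<in>C. x \<noteq> y \<longrightarrow> card (common_neighbors \<Gamma> x y) = l\<^sub>1"
    and diff: "\<forall>C\<in>P. \<forall>C'\<in>P. C \<noteq> C' \<longrightarrow>
      (\<forall>x\<in>C. \<forall>y\<in>C'. card (common_neighbors \<Gamma> x y) = l\<^sub>2)"
    unfolding divisible_design_graph_def by (elim conjE exE) (rule that)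
  interpret pair_graph \<Gamma> by fact
  obtain f :: "'v \<Rightarrow> nat" where f: "inj_on f ?V"
    using finite_imp_inj_to_nat_seg[OF pair_finite_verts] by metis
  define \<Gamma>' where "\<Gamma>' = \<lparr>pverts = f ` ?V, parcs = map_prod f f ` ?A\<rparr>"
  have f_eq: "f x = f y \<longleftrightarrow> x = y" if "x \<in> ?V" "y \<in> ?V" for x y
    using f that by (auto dest: inj_onD)
  have arcs: "x \<in> ?V" "y \<in> ?V" if "(x, y) \<in> ?A" for x y
    using wellformed' that by auto
  have nb_sub: "neighbors \<Gamma> x \<subseteq> ?V" for x
    using arcs by (auto simp: neighbors_def)
  have nb: "neighbors \<Gamma>' (f x) = f ` neighbors \<Gamma> x" if "x \<in> ?V" for x
  proof (intro equalityI subsetI)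
    fix v assume "v \<in> neighbors \<Gamma>' (f x)"
    then obtain a b where ab: "(a, b) \<in> ?A" "f x = f a" "v = f b"
      by (auto simp: neighbors_def \<Gamma>'_def)
    then have "x = a"
      using f_eq[of x a] that arcs(1) by simp
    then show "v \<in> f ` neighbors \<Gamma> x"
      using ab by (simp add: neighbors_def)
  next
    fix v assume "v \<in> f ` neighbors \<Gamma> x"
    then obtain y where "(x, y) \<in> ?A" "v = f y"
      by (auto simp: neighbors_def)
    then have "(f x, v) \<in> map_prod f f ` ?A"
      by (intro image_eqI[of _ _ "(x, y)"]) simp_all
    then show "v \<in> neighbors \<Gamma>' (f x)"
      by (simp add: neighbors_def \<Gamma>'_def)
  qed
  have cn: "card (common_neighbors \<Gamma>' (f x) (f y)) = card (common_neighbors \<Gamma> x y)"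
    if "x \<in> ?V" "y \<in> ?V" for x y
  proof -
    have "common_neighbors \<Gamma>' (f x) (f y) = f ` common_neighbors \<Gamma> x y"
      unfolding common_neighbors_def nb[OF that(1)] nb[OF that(2)]
      using inj_on_image_Int[OF f nb_sub nb_sub] by simp
    then show ?thesis
      using nb_sub by (auto simp: common_neighbors_def intro!: card_image inj_on_subset[OF f])
  qed
  have P_sub: "C \<subseteq> ?V" if "C \<in> P" for C
    using part that by (auto simp: partition_on_def)
  have "pair_graph \<Gamma>'"
  proof
    show "finite (pverts \<Gamma>')" "finite (parcs \<Gamma>')"
      using pair_finite_verts pair_finite_arcs by (auto simp: \<Gamma>'_def)
    show "fst e \<in> pverts \<Gamma>'" "snd e \<in> pverts \<Gamma>'" if "e \<in> parcs \<Gamma>'" for e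
      using that arcs by (auto simp: \<Gamma>'_def)
    show "fst e \<noteq> snd e" if "e \<in> parcs \<Gamma>'" for e
      using that arcs f_eq no_loops' by (auto simp: \<Gamma>'_def)
    show "symmetric (with_proj \<Gamma>')"
    proof -
      have "(v, u) \<in> map_prod f f ` ?A" if uv: "(u, v) \<in> map_prod f f ` ?A" for u v
      proof -
        obtain a b where "(a, b) \<in> ?A" "u = f a" "v = f b"
          using uv by auto
        moreover have "(b, a) \<in> ?A"
          using pair_sym_arcs \<open>(a, b) \<in> ?A\<close> by (auto simp: symmetric_def dest: symD)
        ultimately show ?thesis
          by (intro image_eqI[of _ _ "(b, a)"]) simp_all
      qed
      then have "sym (map_prod f f ` ?A)"
        by (rule symI)
      then show ?thesis
        by (simp add: \<Gamma>'_def symmetric_def)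
    qed
  qed
  moreover have "partition_on (pverts \<Gamma>') ((`) f ` P)"
  proof -
    have "{} \<notin> (`) f ` P"
      using partition_onD3[OF part] by auto
    then show ?thesis
      using partition_on_inj_image[OF part f] by (simp add: \<Gamma>'_def)
  qed
  moreover have "card ((`) f ` P) = m"
    using \<open>card P = m\<close> card_image[OF inj_on_subset[OF inj_on_image_Pow[OF f]], of P] P_sub
    by blast
  moreover have "\<forall>C\<in>(`) f ` P. card C = n"
    using card_C card_image[OF inj_on_subset[OF f P_sub]] by auto
  moreover have "\<forall>C\<in>(`) f ` P. \<forall>x\<in>C. \<forall>y\<in>C. x \<noteq> y \<longrightarrow> card (common_neighbors \<Gamma>' x y) = l\<^sub>1"
  proof (intro ballI impI)
    fix C x y
    assume "C \<in> (`) f ` P" "x \<in> C" "y \<in> C" "x \<noteq> y"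
    then obtain B x' y' where "B \<in> P" "x' \<in> B" "y' \<in> B" "x' \<noteq> y'" "x = f x'" "y = f y'"
      by blast
    then show "card (common_neighbors \<Gamma>' x y) = l\<^sub>1"
      using same cn[of x' y'] P_sub[of B] by auto
  qed
  moreover have "\<forall>C\<in>(`) f ` P. \<forall>C'\<in>(`) f ` P. C \<noteq> C' \<longrightarrow>
      (\<forall>x\<in>C. \<forall>y\<in>C'. card (common_neighbors \<Gamma>' x y) = l\<^sub>2)"
  proof (intro ballI impI)
    fix C C' x y
    assume "C \<in> (`) f ` P" "C' \<in> (`) f ` P" "C \<noteq> C'" "x \<in> C" "y \<in> C'"
    then obtain B B' x' y' where B: "B \<in> P" "B' \<in> P" "B \<noteq> B'" "x' \<in> B" "y' \<in> B'"
      "x = f x'" "y = f y'" by blast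
    then have "x' \<in> ?V" "y' \<in> ?V" "card (common_neighbors \<Gamma> x' y') = l\<^sub>2"
      using diff P_sub by blast+
    then show "card (common_neighbors \<Gamma>' x y) = l\<^sub>2"
      by (simp add: B cn)
  qed
  moreover have "card (pverts \<Gamma>') = v"
    using card_V f by (simp add: \<Gamma>'_def card_image)
  moreover have "\<forall>x\<in>pverts \<Gamma>'. card (neighbors \<Gamma>' x) = k"
  proof
    fix x assume "x \<in> pverts \<Gamma>'"
    then obtain x' where "x' \<in> ?V" "x = f x'"
      by (auto simp: \<Gamma>'_def)
    then show "card (neighbors \<Gamma>' x) = k"
      using deg[of x'] nb[of x'] card_image[OF inj_on_subset[OF f nb_sub]] by simp
  qed
  ultimately have "divisible_design_graph \<Gamma>' v k l\<^sub>1 l\<^sub>2 m n"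
    unfolding divisible_design_graph_def by (intro conjI exI[of _ "(`) f ` P"]) assumption+
  then show ?thesis ..
qed

text \<open>
  These are the symmetric balanced generalized weighing matrices over \<open>G\<close> with zero diagonal and
  nonzero entries elsewhere: any two rows, compared at the columns where both are nonzero, have
  every element of \<open>G\<close> as quotient equally often. The values \<open>w x x\<close> stand for the zeros of the
  matrix and are unconstrained.
\<close>

definition balanced_weighing :: "('g, 'b) monoid_scheme \<Rightarrow> 'x set \<Rightarrow> ('x \<Rightarrow> 'x \<Rightarrow> 'g) \<Rightarrow> nat \<Rightarrow> bool" where
  "balanced_weighing G X w \<mu> \<longleftrightarrow>
     (\<forall>x\<in>X. \<forall>y\<in>X. x \<noteq> y \<longrightarrow> w x y \<in> carrier G \<and> w x y = w y x \<and>
        (\<forall>c\<in>carrier G. card {z \<in> X - {x, y}. w x z = c \<otimes>\<^bsub>G\<^esub> w y z} = \<mu>))"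

text \<open>
  Replacing the nonzero entry \<open>w x y\<close> by the \<open>0/1\<close> matrix of the condition
  \<open>w x y \<otimes> g \<otimes> h \<in> D\<close> on \<open>(g, h)\<close>, and zero entries by zero blocks, gives this adjacency matrix.
  The condition multiplies \<open>g\<close> and \<open>h\<close> instead of dividing them, so that each block
  is symmetric when \<open>G\<close> is commutative.
\<close>

definition weighing_graph ::
  "('g, 'b) monoid_scheme \<Rightarrow> 'x set \<Rightarrow> ('x \<Rightarrow> 'x \<Rightarrow> 'g) \<Rightarrow> 'g set \<Rightarrow> ('x \<times> 'g) pair_pre_digraph" where
  "weighing_graph G X w D = \<lparr>pverts = X \<times> carrier G,
     parcs = {((x, g), (y, h)). x \<in> X \<and> y \<in> X \<and> x \<noteq> y \<and> g \<in> carrier G \<and> h \<in> carrier G \<and>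
       w x y \<otimes>\<^bsub>G\<^esub> (g \<otimes>\<^bsub>G\<^esub> h) \<in> D}\<rparr>"

context comm_group
begin

lemma card_translate_in:
  assumes "D \<subseteq> carrier G" and a: "a \<in> carrier G"
  shows "card {h \<in> carrier G. a \<otimes> h \<in> D} = card D"
proof (rule bij_betw_same_card)
  show "bij_betw (\<lambda>h. a \<otimes> h) {h \<in> carrier G. a \<otimes> h \<in> D} D"
    using assms by (intro bij_betwI[where g = "\<lambda>d. inv a \<otimes> d"]) (auto simp: inv_solve_left m_assoc[symmetric])
qed

text \<open>
  The pairs \<open>(a \<otimes> h, b \<otimes> h)\<close> counted here are exactly the representations of the nonidentity element
  \<open>a \<otimes> inv b\<close> as a quotient of two elements of \<open>D\<close>.
\<close>

lemma card_two_translates_in: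
  assumes D: "difference_set G D n k l" and a: "a \<in> carrier G" and b: "b \<in> carrier G" and "a \<noteq> b"
  shows "card {h \<in> carrier G. a \<otimes> h \<in> D \<and> b \<otimes> h \<in> D} = l"
proof -
  let ?S = "{(d, d'). d \<in> D \<and> d' \<in> D \<and> a \<otimes> inv b = d \<otimes> inv d'}"
  have sub: "D \<subseteq> carrier G"
    using D by (simp add: difference_set_def)
  have "bij_betw (\<lambda>h. (a \<otimes> h, b \<otimes> h)) {h \<in> carrier G. a \<otimes> h \<in> D \<and> b \<otimes> h \<in> D} ?S"
  proof (rule bij_betwI[where g = "\<lambda>(d, d'). inv a \<otimes> d"])
    have "a \<otimes> inv b = (a \<otimes> h) \<otimes> inv (b \<otimes> h)" if "h \<in> carrier G" for h
      using a b that by (simp add: inv_mult m_ac)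
    then show "(\<lambda>h. (a \<otimes> h, b \<otimes> h)) \<in> {h \<in> carrier G. a \<otimes> h \<in> D \<and> b \<otimes> h \<in> D} \<rightarrow> ?S"
      by auto
    have "b \<otimes> (inv a \<otimes> d) = d'"
      if "d \<in> carrier G" "d' \<in> carrier G" "a \<otimes> inv b = d \<otimes> inv d'" for d d'
    proof -
      have "d = (a \<otimes> inv b) \<otimes> d'"
        using that a b by (simp add: m_assoc)
      then show ?thesis
        using that a b by (simp add: m_ac) (metis inv_closed l_inv m_assoc m_closed m_comm r_one)
    qed
    then show "(\<lambda>(d, d'). inv a \<otimes> d) \<in> ?S \<rightarrow> {h \<in> carrier G. a \<otimes> h \<in> D \<and> b \<otimes> h \<in> D}"
      and "\<And>y. y \<in> ?S \<Longrightarrow> (case case y of (d, d') \<Rightarrow> inv a \<otimes> d of h \<Rightarrow> (a \<otimes> h, b \<otimes> h)) = y"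
      using sub a by (auto simp: m_assoc[symmetric] subset_iff)
  qed (use a b in \<open>auto simp: m_assoc[symmetric]\<close>)
  then have "card {h \<in> carrier G. a \<otimes> h \<in> D \<and> b \<otimes> h \<in> D} = card ?S"
    by (rule bij_betw_same_card)
  moreover have "a \<otimes> inv b \<in> carrier G - {\<one>}"
    using a b \<open>a \<noteq> b\<close> by (metis DiffI inv_closed inv_equality inv_inv m_closed singletonD)
  ultimately show ?thesis
    using D by (simp add: difference_set_def)
qed

text \<open>
  A vertex \<open>(x, g)\<close> has neighbours in each of the \<open>card X - 1\<close> classes other than its own. Inside one class,
  the neighbours are a translate of \<open>D\<close>, and the common neighbours of two vertices of one class
  are the intersection of two different translates, so \<open>k\<close> and \<open>l\<close> are multiplied by that number
  of classes. For vertices \<open>(x, g)\<close> and \<open>(y, g')\<close> of different classes, a common neighbour \<open>(z, h)\<close>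
  produces a pair of elements \<open>d = w x z \<otimes> g \<otimes> h\<close> and \<open>d' = w y z \<otimes> g' \<otimes> h\<close> of \<open>D\<close>.
  Conversely, a given pair determines the quotient of \<open>w x z\<close> and \<open>w y z\<close>, which leaves \<open>\<mu>\<close>
  choices for \<open>z\<close>, and then \<open>h\<close> is determined.
\<close>

lemma divisible_design_weighing_graph:
  assumes "finite X" and w: "balanced_weighing G X w \<mu>" and D: "difference_set G D n k l"
  shows "divisible_design_graph (weighing_graph G X w D)
    (n * card X) (k * (card X - 1)) (l * (card X - 1)) (k\<^sup>2 * \<mu>) (card X) n"
proof -
  let ?\<Gamma> = "weighing_graph G X w D"
  have fin: "finite (carrier G)" and card_G: "card (carrier G) = n" and D_sub: "D \<subseteq> carrier G"
    and card_D: "card D = k"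
    using D by (auto simp: difference_set_def order_def)
  have w_closed: "w x y \<in> carrier G" and w_sym: "w x y = w y x"
    and w_bal: "c \<in> carrier G \<Longrightarrow> card {z \<in> X - {x, y}. w x z = c \<otimes> w y z} = \<mu>"
    if "x \<in> X" "y \<in> X" "x \<noteq> y" for x y c
    using w that by (auto simp: balanced_weighing_def)
  have nb: "neighbors ?\<Gamma> (x, g)
      = (SIGMA z:X - {x}. {h \<in> carrier G. (w x z \<otimes> g) \<otimes> h \<in> D})"
    if "x \<in> X" "g \<in> carrier G" for x g
    using that w_closed by (auto simp: neighbors_def weighing_graph_def m_assoc)
  have graph: "pair_graph ?\<Gamma>"
  proof
    show "finite (pverts ?\<Gamma>)"
      using fin \<open>finite X\<close> by (simp add: weighing_graph_def)
    moreover have "parcs ?\<Gamma> \<subseteq> pverts ?\<Gamma> \<times> pverts ?\<Gamma>"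
      by (auto simp: weighing_graph_def)
    ultimately show "finite (parcs ?\<Gamma>)"
      by (meson finite_SigmaI finite_subset)
    show "symmetric (with_proj ?\<Gamma>)"
      using w_sym by (auto simp: weighing_graph_def symmetric_def intro!: symI) (metis m_comm)
  qed (auto simp: weighing_graph_def)
  have card_V: "card (pverts ?\<Gamma>) = n * card X"
    by (simp add: weighing_graph_def card_cartesian_product card_G)
  have degree: "card (neighbors ?\<Gamma> v) = k * (card X - 1)" if v: "v \<in> pverts ?\<Gamma>" for v
  proof -
    obtain x g where xg: "v = (x, g)" "x \<in> X" "g \<in> carrier G"
      using v by (auto simp: weighing_graph_def)
    have "card (neighbors ?\<Gamma> v)
        = (\<Sum>z\<in>X - {x}. card {h \<in> carrier G. (w x z \<otimes> g) \<otimes> h \<in> D})"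
      unfolding xg(1) nb[OF xg(2,3)] by (rule card_SigmaI) (use \<open>finite X\<close> fin in auto)
    also have "\<dots> = (\<Sum>z\<in>X - {x}. k)"
      using xg w_closed by (intro sum.cong) (auto simp: card_translate_in[OF D_sub] card_D)
    finally show ?thesis
      using xg(2) \<open>finite X\<close> by simp
  qed
  have same_class: "card (common_neighbors ?\<Gamma> (x, g) (x, g')) = l * (card X - 1)"
    if "x \<in> X" "g \<in> carrier G" "g' \<in> carrier G" "g \<noteq> g'" for x g g'
  proof -
    have "common_neighbors ?\<Gamma> (x, g) (x, g') = (SIGMA z:X - {x}.
        {h \<in> carrier G. (w x z \<otimes> g) \<otimes> h \<in> D \<and> (w x z \<otimes> g') \<otimes> h \<in> D})"
      unfolding common_neighbors_def nb[OF that(1,2)] nb[OF that(1,3)] by auto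
    then have "card (common_neighbors ?\<Gamma> (x, g) (x, g')) = (\<Sum>z\<in>X - {x}.
        card {h \<in> carrier G. (w x z \<otimes> g) \<otimes> h \<in> D \<and> (w x z \<otimes> g') \<otimes> h \<in> D})"
      using \<open>finite X\<close> fin by (simp add: card_SigmaI)
    also have "\<dots> = (\<Sum>z\<in>X - {x}. l)"
      using that w_closed by (intro sum.cong card_two_translates_in[OF D]) auto
    finally show ?thesis
      using that(1) \<open>finite X\<close> by simp
  qed
  have other_class: "card (common_neighbors ?\<Gamma> (x, g) (y, g')) = k\<^sup>2 * \<mu>"
    if xy: "x \<in> X" "y \<in> X" "x \<noteq> y" and g: "g \<in> carrier G" and g': "g' \<in> carrier G" for x y g g'
  proof -
    \<comment> \<open>the quotient of the two weights that is forced by the pair (d, d')\<close>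
    define c where "c = (\<lambda>(d, d'). (d \<otimes> inv d') \<otimes> (g' \<otimes> inv g))"
    let ?S = "SIGMA p:D \<times> D. {z \<in> X - {x, y}. w x z = c p \<otimes> w y z}"
    have c_iff: "a = c (d, d') \<otimes> b \<longleftrightarrow> a \<otimes> (g \<otimes> d') = d \<otimes> (g' \<otimes> b)"
      if abd: "a \<in> carrier G" "b \<in> carrier G" "d \<in> carrier G" "d' \<in> carrier G" for a b d d'
    proof -
      have c: "c (d, d') \<in> carrier G"
        using abd g g' by (simp add: c_def)
      have "(c (d, d') \<otimes> b) \<otimes> (g \<otimes> d')
          = (d \<otimes> (g' \<otimes> b)) \<otimes> ((inv d' \<otimes> d') \<otimes> (inv g \<otimes> g))"
        using abd g g' by (simp add: c_def m_ac del: l_inv r_inv)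
      also have "\<dots> = d \<otimes> (g' \<otimes> b)"
        using abd g g' by simp
      finally show ?thesis
        using right_cancel[of "g \<otimes> d'" a "c (d, d') \<otimes> b"] abd g g' c by auto
    qed
    have "bij_betw (\<lambda>(z, h). (((w x z \<otimes> g) \<otimes> h, (w y z \<otimes> g') \<otimes> h), z))
        (common_neighbors ?\<Gamma> (x, g) (y, g')) ?S"
    proof (rule bij_betwI[where g = "\<lambda>(p, z). (z, inv (w x z \<otimes> g) \<otimes> fst p)"])
      have cn: "common_neighbors ?\<Gamma> (x, g) (y, g') = (SIGMA z:X - {x, y}.
          {h \<in> carrier G. (w x z \<otimes> g) \<otimes> h \<in> D \<and> (w y z \<otimes> g') \<otimes> h \<in> D})"
        unfolding common_neighbors_def nb[OF xy(1) g] nb[OF xy(2) g'] by auto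
      have w_G: "w x z \<in> carrier G" "w y z \<in> carrier G" if "z \<in> X - {x, y}" for z
        using that xy w_closed by auto
      show "(\<lambda>(z, h). (((w x z \<otimes> g) \<otimes> h, (w y z \<otimes> g') \<otimes> h), z))
          \<in> common_neighbors ?\<Gamma> (x, g) (y, g') \<rightarrow> ?S"
        unfolding cn using w_G g g' by (auto simp: c_iff m_ac)
      have inv_cancel: "inv u \<otimes> (u \<otimes> h) = h" if "u \<in> carrier G" "h \<in> carrier G" for u h
        using that m_assoc[of "inv u" u h] by simp
      have snd_eq: "(w y z \<otimes> g') \<otimes> (inv (w x z \<otimes> g) \<otimes> d) = d'"
        if "z \<in> X - {x, y}" "d \<in> carrier G" "d' \<in> carrier G" "w x z = c (d, d') \<otimes> w y z" for z d d'
      proof -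
        have "(w y z \<otimes> g') \<otimes> (inv (w x z \<otimes> g) \<otimes> d)
            = inv (w x z \<otimes> g) \<otimes> (d \<otimes> (g' \<otimes> w y z))"
          using that(2) w_G[OF that(1)] g g' by (simp add: m_ac)
        also have "\<dots> = inv (w x z \<otimes> g) \<otimes> ((w x z \<otimes> g) \<otimes> d')"
          using iffD1[OF c_iff that(4)] that(2,3) w_G[OF that(1)] g by (simp add: m_assoc)
        also have "\<dots> = d'"
          using that(3) w_G[OF that(1)] g by (simp add: inv_cancel)
        finally show ?thesis .
      qed
      have fst_eq: "(w x z \<otimes> g) \<otimes> (inv (w x z \<otimes> g) \<otimes> d) = d"
        if "z \<in> X - {x, y}" "d \<in> carrier G" for z d
        using that w_G g by (simp add: m_assoc[symmetric])
      show "(\<lambda>(p, z). (z, inv (w x z \<otimes> g) \<otimes> fst p)) \<in> ?S \<rightarrow> common_neighbors ?\<Gamma> (x, g) (y, g')"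
      proof
        fix v assume "v \<in> ?S"
        then obtain d d' z where v: "v = ((d, d'), z)" "d \<in> D" "d' \<in> D" "z \<in> X - {x, y}"
          "w x z = c (d, d') \<otimes> w y z" by blast
        then have "d \<in> carrier G" "d' \<in> carrier G"
          using D_sub by auto
        then show "(case v of (p, z) \<Rightarrow> (z, inv (w x z \<otimes> g) \<otimes> fst p))
            \<in> common_neighbors ?\<Gamma> (x, g) (y, g')"
          unfolding cn using v(1-4) w_G[OF v(4)] g fst_eq[OF v(4)] snd_eq[OF v(4) _ _ v(5)] by simp
      qed
      show "(case case v of (z, h) \<Rightarrow> (((w x z \<otimes> g) \<otimes> h, (w y z \<otimes> g') \<otimes> h), z) of
          (p, z) \<Rightarrow> (z, inv (w x z \<otimes> g) \<otimes> fst p)) = v"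
        if "v \<in> common_neighbors ?\<Gamma> (x, g) (y, g')" for v
        using that w_G g unfolding cn by (auto simp: inv_cancel)
      show "(case case v of (p, z) \<Rightarrow> (z, inv (w x z \<otimes> g) \<otimes> fst p) of
          (z, h) \<Rightarrow> (((w x z \<otimes> g) \<otimes> h, (w y z \<otimes> g') \<otimes> h), z)) = v"
        if "v \<in> ?S" for v
      proof -
        obtain d d' z where v: "v = ((d, d'), z)" "d \<in> D" "d' \<in> D" "z \<in> X - {x, y}"
          "w x z = c (d, d') \<otimes> w y z" using \<open>v \<in> ?S\<close> by blast
        then have "d \<in> carrier G" "d' \<in> carrier G"
          using D_sub by auto
        then show ?thesis
          using v(1) fst_eq[OF v(4)] snd_eq[OF v(4) _ _ v(5)] by simp
      qed
    qed
    then have "card (common_neighbors ?\<Gamma> (x, g) (y, g')) = card ?S"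
      by (rule bij_betw_same_card)
    also have "\<dots> = (\<Sum>p\<in>D \<times> D. card {z \<in> X - {x, y}. w x z = c p \<otimes> w y z})"
      using \<open>finite X\<close> finite_subset[OF D_sub fin] by (intro card_SigmaI) auto
    also have "\<dots> = (\<Sum>p\<in>D \<times> D. \<mu>)"
      using D_sub g g' by (intro sum.cong w_bal[OF xy]) (auto simp: c_def)
    finally show ?thesis
      by (simp add: card_cartesian_product card_D power2_eq_square)
  qed
  note graph card_V
  moreover have "\<forall>v\<in>pverts ?\<Gamma>. card (neighbors ?\<Gamma> v) = k * (card X - 1)"
    using degree by blast
  moreover have "carrier G \<noteq> {}"
    using one_closed by blast
  then have "partition_on (pverts ?\<Gamma>) ((\<lambda>x. {x} \<times> carrier G) ` X)"
    by (intro partition_onI) (auto simp: weighing_graph_def disjnt_def)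
  moreover have "card ((\<lambda>x. {x} \<times> carrier G) ` X) = card X"
    using \<open>carrier G \<noteq> {}\<close> by (intro card_image inj_onI) (auto simp: times_eq_iff)
  moreover have "\<forall>C\<in>(\<lambda>x. {x} \<times> carrier G) ` X. card C = n"
    by (auto simp: card_cartesian_product card_G)
  moreover have "\<forall>C\<in>(\<lambda>x. {x} \<times> carrier G) ` X. \<forall>u\<in>C. \<forall>v\<in>C. u \<noteq> v \<longrightarrow>
      card (common_neighbors ?\<Gamma> u v) = l * (card X - 1)"
    using same_class by auto
  moreover have "\<forall>C\<in>(\<lambda>x. {x} \<times> carrier G) ` X. \<forall>C'\<in>(\<lambda>x. {x} \<times> carrier G) ` X. C \<noteq> C' \<longrightarrow>
      (\<forall>u\<in>C. \<forall>v\<in>C'. card (common_neighbors ?\<Gamma> u v) = k\<^sup>2 * \<mu>)"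
    using other_class by auto
  ultimately show ?thesis
    unfolding divisible_design_graph_def
    by (intro conjI exI[of _ "(\<lambda>x. {x} \<times> carrier G) ` X"]) assumption+
qed

end

section \<open>The ring generated by a root of unity\<close>

text \<open>
  The subring \<open>\<int>[z]\<close> generated by \<open>z\<close>.
\<close>

inductive_set int_adjoin :: "'a::comm_ring_1 \<Rightarrow> 'a set" for z where
  of_int: "of_int a \<in> int_adjoin z"
| gen: "z \<in> int_adjoin z"
| add: "x \<in> int_adjoin z \<Longrightarrow> y \<in> int_adjoin z \<Longrightarrow> x + y \<in> int_adjoin z"
| mult: "x \<in> int_adjoin z \<Longrightarrow> y \<in> int_adjoin z \<Longrightarrow> x * y \<in> int_adjoin z"

lemma int_adjoin_0: "0 \<in> int_adjoin z" and int_adjoin_1: "1 \<in> int_adjoin z"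
  using int_adjoin.of_int[of 0 z] int_adjoin.of_int[of 1 z] by simp_all

lemma int_adjoin_of_nat: "of_nat n \<in> int_adjoin z"
  using int_adjoin.of_int[of "int n" z] by simp

lemma int_adjoin_uminus: "x \<in> int_adjoin z \<Longrightarrow> - x \<in> int_adjoin z"
  using int_adjoin.mult[OF int_adjoin.of_int[of "-1" z]] by simp

lemma int_adjoin_diff: "x \<in> int_adjoin z \<Longrightarrow> y \<in> int_adjoin z \<Longrightarrow> x - y \<in> int_adjoin z"
  using int_adjoin.add[of x z "- y"] int_adjoin_uminus[of y z] by simp

lemma int_adjoin_power: "x \<in> int_adjoin z \<Longrightarrow> x ^ n \<in> int_adjoin z"
  by (induction n) (auto intro: int_adjoin.mult int_adjoin_1)

lemma int_adjoin_sum: "(\<And>i. i \<in> A \<Longrightarrow> f i \<in> int_adjoin z) \<Longrightarrow> sum f A \<in> int_adjoin z"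
  by (induction A rule: infinite_finite_induct) (auto intro: int_adjoin.add int_adjoin_0)

lemmas int_adjoin_closed =
  int_adjoin.intros int_adjoin_0 int_adjoin_1 int_adjoin_of_nat int_adjoin_uminus int_adjoin_diff
  int_adjoin_power int_adjoin_sum

definition int_adjoin_ring :: "'a::comm_ring_1 \<Rightarrow> 'a ring" where
  "int_adjoin_ring z = \<lparr>carrier = int_adjoin z, mult = (*), one = 1, zero = 0, add = (+)\<rparr>"

lemma int_adjoin_ring_simps [simp]:
  "carrier (int_adjoin_ring z) = int_adjoin z"
  "x \<otimes>\<^bsub>int_adjoin_ring z\<^esub> y = x * y"
  "\<one>\<^bsub>int_adjoin_ring z\<^esub> = 1"
  "\<zero>\<^bsub>int_adjoin_ring z\<^esub> = 0"
  "x \<oplus>\<^bsub>int_adjoin_ring z\<^esub> y = x + y"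
  by (simp_all add: int_adjoin_ring_def)

lemma cring_int_adjoin_ring: "cring (int_adjoin_ring z)"
proof (rule cringI)
  show "abelian_group (int_adjoin_ring z)"
    by (rule abelian_groupI)
      (auto intro: int_adjoin_closed bexI[of _ "- _"] simp: algebra_simps)
  show "comm_monoid (int_adjoin_ring z)"
    by (rule comm_monoidI) (auto intro: int_adjoin_closed simp: algebra_simps)
qed (auto simp: algebra_simps)

lemma a_inv_int_adjoin_ring:
  "x \<in> int_adjoin z \<Longrightarrow> \<ominus>\<^bsub>int_adjoin_ring z\<^esub> x = - x"
proof -
  assume x: "x \<in> int_adjoin z"
  interpret cring "int_adjoin_ring z" by (rule cring_int_adjoin_ring)
  show ?thesis
    using minus_equality[of "- x" x] x by (simp add: int_adjoin_uminus)
qed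

text \<open>
  This is Nakayama's lemma for the subgroup spanned by the \<open>v i\<close>: it vanishes if it equals its
  \<open>p\<close>-fold multiple. Denominators prime to \<open>p\<close> are cleared by the factors \<open>m\<close>, and
  one generator is eliminated at a time: moving the term of \<open>v a\<close> on the right to the left keeps
  the factor of \<open>v a\<close> congruent to 1, and substituting the result in the other relations
  keeps their form.
\<close>

lemma eq_0_if_in_p_span:
  fixes v :: "'i \<Rightarrow> 'a::{idom, ring_char_0}" and p :: int
  assumes "finite A" and p: "\<not> is_unit p"
    and "\<And>i. i \<in> A \<Longrightarrow> \<exists>m c. [m = 1] (mod p) \<and> of_int m * v i = (\<Sum>j\<in>A. of_int (p * c j) * v j)"
  shows "\<forall>i\<in>A. v i = 0"
  using assms(1,3)
proof (induction A rule: finite_induct)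
  case (insert a A)
  obtain m c where ma: "[m = 1] (mod p)"
    and "of_int m * v a = (\<Sum>j\<in>insert a A. of_int (p * c j) * v j)"
    using insert.prems by blast
  then have va: "of_int (m - p * c a) * v a = (\<Sum>j\<in>A. of_int (p * c j) * v j)"
    using insert.hyps by (simp add: algebra_simps)
  have m': "[m - p * c a = 1] (mod p)"
    using cong_diff[OF ma, of "p * c a" 0] by (simp add: cong_0_iff)
  have IH: "\<forall>i\<in>A. v i = 0"
  proof (rule insert.IH)
    fix i assume "i \<in> A"
    then obtain n d where n: "[n = 1] (mod p)"
      and "of_int n * v i = (\<Sum>j\<in>insert a A. of_int (p * d j) * v j)"
      using insert.prems by blast
    then have vi: "of_int n * v i = of_int (p * d a) * v a + (\<Sum>j\<in>A. of_int (p * d j) * v j)"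
      using insert.hyps by simp
    have "of_int ((m - p * c a) * n) * v i
        = of_int (p * d a) * (of_int (m - p * c a) * v a)
          + of_int (m - p * c a) * (\<Sum>j\<in>A. of_int (p * d j) * v j)"
      by (simp add: vi mult.assoc) (simp add: algebra_simps)
    also have "\<dots> = (\<Sum>j\<in>A. of_int (p * (p * d a * c j + (m - p * c a) * d j)) * v j)"
      unfolding va by (simp add: sum_distrib_left sum.distrib[symmetric] algebra_simps)
    finally have "of_int ((m - p * c a) * n) * v i
        = (\<Sum>j\<in>A. of_int (p * (p * d a * c j + (m - p * c a) * d j)) * v j)" .
    moreover have "[(m - p * c a) * n = 1] (mod p)"
      using cong_mult[OF m' n] by simp
    ultimately show "\<exists>m c. [m = 1] (mod p) \<and> of_int m * v i = (\<Sum>j\<in>A. of_int (p * c j) * v j)"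
      by (intro exI conjI)
  qed
  then have "of_int (m - p * c a) * v a = 0"
    using va by simp
  moreover have "m - p * c a \<noteq> 0"
    using m' p by (metis cong_0_iff cong_sym_eq)
  ultimately have "v a = 0"
    by (metis mult_eq_0_iff of_int_eq_0_iff)
  with IH show ?case by simp
qed simp

lemma int_adjoin_root_of_unity:
  assumes "z ^ N = 1" and "0 < N" and "x \<in> int_adjoin z"
  shows "\<exists>c. x = (\<Sum>i<N. of_int (c i) * z ^ i)"
proof -
  let ?S = "range (\<lambda>c. \<Sum>i<N. of_int (c i) * z ^ i)"
  have pow: "of_int a * z ^ k \<in> ?S" for a k
  proof
    have "z ^ k = z ^ (k mod N) * (z ^ N) ^ (k div N)"
      by (metis mod_mult_div_eq power_add power_mult)
    then have "of_int a * z ^ k = (\<Sum>i<N. if i = k mod N then of_int a * z ^ i else 0)"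
      using assms(1,2) by simp
    also have "\<dots> = (\<Sum>i<N. of_int (if i = k mod N then a else 0) * z ^ i)"
      by (rule sum.cong) auto
    finally show "of_int a * z ^ k = (\<Sum>i<N. of_int (if i = k mod N then a else 0) * z ^ i)" .
  qed simp
  have S_add: "x + y \<in> ?S" if "x \<in> ?S" "y \<in> ?S" for x y
  proof -
    from that obtain c d where "x = (\<Sum>i<N. of_int (c i) * z ^ i)" "y = (\<Sum>i<N. of_int (d i) * z ^ i)"
      by blast
    then have "x + y = (\<Sum>i<N. of_int (c i + d i) * z ^ i)"
      by (simp add: sum.distrib algebra_simps)
    then show ?thesis
      by (rule range_eqI[where x = "\<lambda>i. c i + d i"])
  qed
  have S_sum: "sum f A \<in> ?S" if "finite A" "\<And>i. i \<in> A \<Longrightarrow> f i \<in> ?S" for f :: "nat \<Rightarrow> 'a" and A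
    using that
  proof (induction A rule: finite_induct)
    case empty
    show ?case using pow[of 0 0] by simp
  qed (auto intro: S_add)
  have "x \<in> ?S"
    using assms(3)
  proof (induction rule: int_adjoin.induct)
    case (of_int a)
    show ?case using pow[of a 0] by simp
  next
    case gen
    show ?case using pow[of 1 1] by simp
  next
    case (add x y)
    then show ?case by (intro S_add)
  next
    case (mult x y)
    then obtain c d where "x = (\<Sum>i<N. of_int (c i) * z ^ i)" "y = (\<Sum>i<N. of_int (d i) * z ^ i)"
      by blast
    then have "x * y = (\<Sum>i<N. \<Sum>j<N. of_int (c i * d j) * z ^ (i + j))"
      by (simp add: sum_product power_add algebra_simps)
    also have "\<dots> \<in> ?S"
      by (intro S_sum pow) simp_all
    finally show ?case .
  qed
  then show ?thesis by blast
qed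

text \<open>
  If \<open>p\<close> had the inverse \<open>y\<close>, each power \<open>z ^ i\<close> would be \<open>p\<close> times \<open>y * z ^ i\<close>, hence \<open>p\<close> times an
  integral combination of the finitely many powers of \<open>z\<close>, and all these powers would be zero.
\<close>

lemma int_not_unit_in_int_adjoin_root_of_unity:
  fixes z :: "'a::{idom, ring_char_0}"
  assumes "z ^ N = 1" and "0 < N" and "\<not> is_unit p" and y: "y \<in> int_adjoin z"
  shows "of_int p * y \<noteq> 1"
proof
  assume py: "of_int p * y = 1"
  have "\<forall>i\<in>{..<N}. z ^ i = 0"
  proof (rule eq_0_if_in_p_span[OF _ assms(3)])
    fix i
    have "y * z ^ i \<in> int_adjoin z"
      using y by (auto intro: int_adjoin_closed)
    then obtain c where c: "y * z ^ i = (\<Sum>j<N. of_int (c j) * z ^ j)"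
      using int_adjoin_root_of_unity[OF assms(1,2)] by blast
    have "of_int 1 * z ^ i = of_int p * (y * z ^ i)"
      using py by (simp flip: mult.assoc)
    also have "\<dots> = (\<Sum>j<N. of_int (p * c j) * z ^ j)"
      unfolding c by (simp add: sum_distrib_left mult.assoc)
    finally show "\<exists>m c. [m = 1] (mod p) \<and> of_int m * z ^ i = (\<Sum>j<N. of_int (p * c j) * z ^ j)"
      by (intro exI[of _ 1] exI[of _ c]) simp
  qed simp
  then show False
    using assms(2) by (auto dest: bspec[of _ _ 0])
qed

text \<open>
  For exponent \<open>p\<close> the inner binomial coefficients are divisible by \<open>p\<close>; the general case follows by
  iteration. The statement speaks of an explicit multiple of \<open>p\<close> because divisibility has to hold
  in \<open>\<int>[z]\<close>, not in the ambient ring.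
\<close>

lemma prime_power_binomial_mod_prime:
  assumes p: "prime p" and "a \<in> int_adjoin z" and "b \<in> int_adjoin z"
  shows "\<exists>w\<in>int_adjoin z. (a + b) ^ (p ^ e) = a ^ (p ^ e) + b ^ (p ^ e) + of_nat p * w"
proof -
  have base: "\<exists>w\<in>int_adjoin z. (a + b) ^ p = a ^ p + b ^ p + of_nat p * w"
    if "a \<in> int_adjoin z" "b \<in> int_adjoin z" for a b
  proof
    define w where "w = (\<Sum>k\<in>{0<..<p}. of_nat ((p choose k) div p) * a ^ k * b ^ (p - k))"
    show "w \<in> int_adjoin z"
      unfolding w_def using that by (intro int_adjoin_closed)
    have "{..p} = insert 0 (insert p {0<..<p})"
      using prime_gt_0_nat[OF p] by auto
    then have "(a + b) ^ p
        = a ^ p + b ^ p + (\<Sum>k\<in>{0<..<p}. of_nat (p choose k) * a ^ k * b ^ (p - k))"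
      using prime_gt_0_nat[OF p] by (simp add: binomial_ring algebra_simps)
    also have "(\<Sum>k\<in>{0<..<p}. of_nat (p choose k) * a ^ k * b ^ (p - k)) = of_nat p * w"
      unfolding w_def sum_distrib_left
    proof (rule sum.cong)
      fix k assume "k \<in> {0<..<p}"
      then have "p choose k = p * ((p choose k) div p)"
        using dvd_choose_prime[of k p] p by simp
      then have "(of_nat (p choose k) :: 'a) = of_nat p * of_nat ((p choose k) div p)"
        by (metis of_nat_mult)
      then show "of_nat (p choose k) * a ^ k * b ^ (p - k)
          = of_nat p * (of_nat ((p choose k) div p) * a ^ k * b ^ (p - k))"
        by (simp add: mult.assoc)
    qed simp
    finally show "(a + b) ^ p = a ^ p + b ^ p + of_nat p * w" .
  qed
  show ?thesis
  proof (induction e)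
    case 0
    show ?case by (auto intro!: bexI[of _ 0] int_adjoin_closed)
  next
    case (Suc e)
    let ?q = "p ^ e"
    obtain u where u: "u \<in> int_adjoin z" "(a + b) ^ ?q = a ^ ?q + b ^ ?q + of_nat p * u"
      using Suc.IH by blast
    have ab: "a ^ ?q \<in> int_adjoin z" "b ^ ?q \<in> int_adjoin z" "of_nat p * u \<in> int_adjoin z"
      using assms(2,3) u(1) by (auto intro: int_adjoin_closed)
    obtain v where v: "v \<in> int_adjoin z"
      "(a ^ ?q + b ^ ?q) ^ p = (a ^ ?q) ^ p + (b ^ ?q) ^ p + of_nat p * v"
      using base[OF ab(1,2)] by blast
    obtain w where w: "w \<in> int_adjoin z"
      "((a ^ ?q + b ^ ?q) + of_nat p * u) ^ p
        = (a ^ ?q + b ^ ?q) ^ p + (of_nat p * u) ^ p + of_nat p * w"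
      using base[OF int_adjoin.add[OF ab(1,2)] ab(3)] by blast
    have "(of_nat p * u) ^ p = of_nat p * (u * (of_nat p * u) ^ (p - 1))"
      using prime_gt_0_nat[OF p] by (cases p) (simp_all add: mult.assoc)
    then have "(a + b) ^ (p ^ Suc e) = a ^ (p ^ Suc e) + b ^ (p ^ Suc e)
        + of_nat p * (v + u * (of_nat p * u) ^ (p - 1) + w)"
      unfolding power_Suc2 power_mult u(2) w(2) v(2) by (simp only: distrib_left ac_simps)
    moreover have "v + u * (of_nat p * u) ^ (p - 1) + w \<in> int_adjoin z"
      using u(1) v(1) w(1) by (intro int_adjoin_closed)
    ultimately show ?case by blast
  qed
qed

lemma int_power_prime_power_cong:
  assumes p: "prime p"
  shows "[(a::int) ^ (p ^ e) = a] (mod int p)"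
proof (induction e)
  case (Suc e)
  have fermat: "[b ^ p = b] (mod p)" for b :: nat
  proof (cases "p dvd b")
    case True
    then show ?thesis
      using prime_gt_0_nat[OF p] by (simp add: cong_def dvd_power_iff_le dvd_imp_mod_0 dvd_trans[OF _ dvd_power])
  next
    case False
    then show ?thesis
      using cong_mult[OF cong_refl[of b] fermat_theorem[OF p False]] prime_gt_0_nat[OF p]
      by (simp add: power_eq_if)
  qed
  define b where "b = nat (a mod int p)"
  have b: "[a = int b] (mod int p)"
    using prime_gt_0_nat[OF p] by (simp add: b_def cong_def)
  have "[a ^ p = int b ^ p] (mod int p)"
    using b by (rule cong_pow)
  also have "[int b ^ p = int b] (mod int p)"
    using fermat[of b] by (metis cong_int_iff of_nat_power)
  also have "[int b = a] (mod int p)"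
    using b by (rule cong_sym)
  finally have "[a ^ p = a] (mod int p)" .
  then have "[(a ^ p) ^ (p ^ e) = a ^ (p ^ e)] (mod int p)"
    by (rule cong_pow)
  with Suc.IH show ?case
    by (metis cong_trans power_Suc power_mult)
qed simp

text \<open>
  Modulo \<open>p\<close>, raising to the power \<open>p ^ e\<close> is a ring endomorphism of \<open>\<int>[z]\<close>. It fixes the
  integers, by Fermat's little theorem, and it fixes the generator \<open>z\<close>, so it is the identity.
\<close>

lemma frobenius_mod_prime:
  assumes p: "prime p" and z: "z ^ (p ^ e) = z" and "x \<in> int_adjoin z"
  shows "\<exists>w\<in>int_adjoin z. x ^ (p ^ e) = x + of_nat p * w"
  using assms(3)
proof (induction rule: int_adjoin.induct)
  case (of_int a)
  obtain c where "a ^ (p ^ e) = a + int p * c"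
    using cong_sym[OF int_power_prime_power_cong[OF p, of a e]]
    by (auto simp: cong_iff_lin mult.commute)
  then have "of_int a ^ (p ^ e) = of_int a + of_nat p * (of_int c :: 'a)"
    by (metis of_int_add of_int_mult of_int_of_nat_eq of_int_power)
  then show ?case by (auto intro: int_adjoin_closed)
next
  case gen
  show ?case using z by (auto intro!: bexI[of _ 0] int_adjoin_closed)
next
  case (add x y)
  then obtain u v where uv: "u \<in> int_adjoin z" "v \<in> int_adjoin z"
    "x ^ (p ^ e) = x + of_nat p * u" "y ^ (p ^ e) = y + of_nat p * v" by blast
  obtain w where w: "w \<in> int_adjoin z"
    "(x + y) ^ (p ^ e) = x ^ (p ^ e) + y ^ (p ^ e) + of_nat p * w"
    using prime_power_binomial_mod_prime[OF p add.hyps] by blast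
  have "(x + y) ^ (p ^ e) = x + y + of_nat p * (u + v + w)"
    unfolding w(2) uv(3,4) by (simp add: algebra_simps)
  then show ?case
    using uv(1,2) w(1) by (intro bexI[of _ "u + v + w"] int_adjoin_closed)
next
  case (mult x y)
  then obtain u v where uv: "u \<in> int_adjoin z" "v \<in> int_adjoin z"
    "x ^ (p ^ e) = x + of_nat p * u" "y ^ (p ^ e) = y + of_nat p * v" by blast
  have "(x * y) ^ (p ^ e) = x * y + of_nat p * (x * v + u * y + of_nat p * u * v)"
    unfolding power_mult_distrib uv(3,4) by (simp add: algebra_simps)
  then show ?case
    using uv(1,2) mult.hyps
    by (intro bexI[of _ "x * v + u * y + of_nat p * u * v"] int_adjoin_closed)
qed

text \<open>
  Both sides are monic polynomials of degree \<open>N\<close> in \<open>x\<close> with the same \<open>N\<close> roots.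
\<close>

lemma power_minus_1_eq_prod_roots_of_unity:
  fixes z :: "'a::idom"
  assumes "z ^ N = 1" and "0 < N" and "inj_on (\<lambda>i. z ^ i) {..<N}"
  shows "x ^ N - 1 = (\<Prod>i<N. x - z ^ i)"
proof -
  let ?f = "Polynomial.monom 1 N - 1 :: 'a poly" and ?g = "\<Prod>i<N. [:- (z ^ i), 1:]"
  have deg: "degree ?g = N"
    by (simp add: degree_prod_eq_sum_degree)
  have lead: "lead_coeff ?g = 1"
    by (simp add: lead_coeff_prod)
  have "?f = ?g"
  proof (rule poly_eqI_degree_lead_coeff[where n = N and A = "(\<lambda>i. z ^ i) ` {..<N}"])
    show "poly.coeff ?f N = poly.coeff ?g N"
      using lead deg assms(2) by (simp add: one_pCons coeff_pCons split: nat.split)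
    show "N \<le> card ((\<lambda>i. z ^ i) ` {..<N})"
      using assms(3) by (simp add: card_image)
    show "degree ?f \<le> N"
      by (simp add: degree_diff_le degree_monom_le)
    show "poly ?f y = poly ?g y" if y: "y \<in> (\<lambda>i. z ^ i) ` {..<N}" for y
    proof -
      obtain i where "y = z ^ i"
        using y by blast
      then have "y ^ N = (z ^ N) ^ i"
        by (simp add: mult.commute flip: power_mult)
      then have "y ^ N = 1"
        using assms(1) by simp
      moreover have "poly ?g y = 0"
        using y by (auto simp: poly_prod)
      ultimately show ?thesis by (simp add: poly_monom)
    qed
  qed (use deg in simp)
  then have "poly ?f x = poly ?g x" by simp
  then show ?thesis by (simp add: poly_monom poly_prod)
qed

section \<open>Finite fields\<close>

text \<open>
  Zorn's lemma, applied to the ideals above \<open>I\<close> that avoid \<open>\<one>\<close>.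
\<close>

lemma (in cring) ideal_in_maximalideal:
  assumes "ideal I R" and "I \<noteq> carrier R"
  shows "\<exists>M. maximalideal M R \<and> I \<subseteq> M"
proof -
  define A where "A = {J. ideal J R \<and> I \<subseteq> J \<and> \<one> \<notin> J}"
  have "I \<in> A"
    using assms ideal.one_imp_carrier by (auto simp: A_def)
  moreover have "\<Union>C \<in> A" if C: "C \<noteq> {}" "subset.chain A C" for C
  proof -
    have C_A: "J \<in> A" if "J \<in> C" for J
      using C(2) that by (auto simp: subset_chain_def)
    have idl: "ideal J R" if "J \<in> C" for J
      using C_A[OF that] by (simp add: A_def)
    note sub = ideal.axioms(1)[OF idl]
    have "ideal (\<Union>C) R"
    proof (intro idealI ring_axioms add.subgroupI)
      show "\<Union>C \<subseteq> carrier R"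
        using additive_subgroup.a_subset[OF sub] by blast
      show "\<Union>C \<noteq> {}"
        using C(1) additive_subgroup.zero_closed[OF sub] by blast
      show "\<ominus> x \<in> \<Union>C" if "x \<in> \<Union>C" for x
        using that additive_subgroup.a_inv_closed[OF sub] by blast
      show "x \<oplus> y \<in> \<Union>C" if xy: "x \<in> \<Union>C" "y \<in> \<Union>C" for x y
      proof -
        from xy obtain J K where JK: "J \<in> C" "K \<in> C" "x \<in> J" "y \<in> K"
          by blast
        have "J \<subseteq> K \<or> K \<subseteq> J"
          using C(2) JK(1,2) by (auto simp: subset_chain_def)
        then have "\<exists>L\<in>C. x \<in> L \<and> y \<in> L"
          using JK by blast
        then obtain L where "L \<in> C" "x \<in> L" "y \<in> L"
          by blast
        then show ?thesis
          using additive_subgroup.a_closed[OF sub] by blast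
      qed
      show "r \<otimes> x \<in> \<Union>C" "x \<otimes> r \<in> \<Union>C" if "x \<in> \<Union>C" "r \<in> carrier R" for x r
        using that ideal.I_l_closed[OF idl] ideal.I_r_closed[OF idl] by blast+
    qed
    moreover have "I \<subseteq> \<Union>C"
      using C(1) C_A unfolding A_def by blast
    moreover have "\<one> \<notin> \<Union>C"
      using C_A unfolding A_def by blast
    ultimately show ?thesis
      by (simp add: A_def)
  qed
  ultimately obtain M where M: "M \<in> A" "\<And>J. J \<in> A \<Longrightarrow> M \<subseteq> J \<Longrightarrow> J = M"
    using subset_Zorn_nonempty[of A] by blast
  have "maximalideal M R"
  proof (rule maximalidealI)
    show "ideal M R" "carrier R \<noteq> M"
      using M(1) one_closed unfolding A_def by blast+
    show "J = M \<or> J = carrier R" if "ideal J R" "M \<subseteq> J" "J \<subseteq> carrier R" for J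
      using M that ideal.one_imp_carrier[of J R] by (auto simp: A_def)
  qed
  then show ?thesis
    using M(1) by (auto simp: A_def)
qed

text \<open>
  The field is a residue field of a cyclotomic ring. Let \<open>q = p ^ e\<close>, let \<open>z\<close> be a primitive complex root of
  unity of order \<open>N = q - 1\<close>, and let \<open>P\<close> be a maximal ideal of \<open>\<int>[z]\<close> that contains \<open>p\<close>; it exists
  because \<open>p\<close> is not a unit. Since \<open>x ^ q - x\<close> is the product of \<open>x\<close> and all \<open>x - z ^ i\<close>, and lies in
  \<open>P\<close> by \<open>frobenius_mod_prime\<close>, every \<open>x\<close> is congruent to \<open>0\<close> or to a power of \<open>z\<close>. These \<open>q\<close> elements are
  incongruent: if \<open>z ^ d\<close> were congruent to 1 with \<open>0 < d < N\<close>, then the vanishing sum of the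
  powers of \<open>z ^ d\<close> would be congruent to \<open>N\<close>, and \<open>P\<close> would contain \<open>N\<close> and \<open>q = N + 1\<close>,
  hence 1.
\<close>

theorem finite_field_exists:
  assumes "primepow q"
  shows "\<exists>F :: complex set ring. field F \<and> finite (carrier F) \<and> card (carrier F) = q"
proof -
  obtain p e where p: "prime p" and e: "0 < e" and q: "q = p ^ e"
    using assms by (auto simp: primepow_def)
  define N where "N = q - 1"
  have q2: "2 \<le> q"
    using primepow_gt_Suc_0[OF assms] by simp
  then have N: "0 < N" "q = Suc N"
    by (auto simp: N_def)
  define z where "z = cis (2 * pi / real N)"
  have zpow: "z ^ k = cis (2 * pi * real k / real N)" for k
    by (simp add: z_def DeMoivre mult_ac)
  have roots: "bij_betw (\<lambda>k. z ^ k) {..<N} {z. z ^ N = 1}"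
    unfolding zpow by (rule bij_betw_roots_unity[OF N(1)])
  have inj: "inj_on (\<lambda>k. z ^ k) {..<N}"
    using roots by (rule bij_betw_imp_inj_on)
  have zN: "z ^ N = 1"
    using N(1) by (simp add: zpow)
  let ?R = "int_adjoin_ring z"
  interpret R: cring ?R by (rule cring_int_adjoin_ring)
  define I where "I = (*) (of_nat p) ` int_adjoin z"
  have "I = PIdl\<^bsub>?R\<^esub> (of_nat p)"
    by (auto simp: I_def cgenideal_def mult.commute)
  then have "ideal I ?R"
    using R.cgenideal_ideal[of "of_nat p"] by (simp add: int_adjoin_of_nat)
  moreover have "1 \<notin> I"
    using int_not_unit_in_int_adjoin_root_of_unity[OF zN N(1), of "int p"] prime_gt_1_nat[OF p]
    by (auto simp: I_def)
  then have "I \<noteq> carrier ?R"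
    using int_adjoin_1[of z] by auto
  ultimately obtain P where "maximalideal P ?R" and IP: "I \<subseteq> P"
    using R.ideal_in_maximalideal by blast
  interpret P: maximalideal P ?R by fact
  interpret P': primeideal P ?R
    using R.maximalideal_prime[OF \<open>maximalideal P ?R\<close>] .
  have P_add: "x + y \<in> P" if "x \<in> P" "y \<in> P" for x y
    using P.a_closed[OF that] by simp
  have P_mult: "x * y \<in> P" if "x \<in> P" "y \<in> int_adjoin z" for x y
    using P.I_r_closed[OF that(1)] that(2) by simp
  have P_diff: "x - y \<in> P" if "x \<in> P" "y \<in> P" for x y
    using P_add[OF that(1) P_mult[OF that(2), of "- 1"]] by (simp add: int_adjoin_closed)
  have P_sum: "sum f A \<in> P" if "finite A" "\<And>i. i \<in> A \<Longrightarrow> f i \<in> P" for f A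
    using that P.zero_closed by (induction A rule: finite_induct) (auto intro: P_add)
  have P_prime: "x \<in> P \<or> y \<in> P" if "x * y \<in> P" "x \<in> int_adjoin z" "y \<in> int_adjoin z" for x y
    using P'.I_prime[of x y] that by simp
  have P_1: "1 \<notin> P"
    using P.one_imp_carrier P.I_notcarr by auto
  have p_mult: "of_nat p * x \<in> P" if "x \<in> int_adjoin z" for x
    using IP that by (auto simp: I_def)
  have prod: "\<exists>i\<in>A. f i \<in> P"
    if "finite A" "\<And>i. i \<in> A \<Longrightarrow> f i \<in> int_adjoin z" "prod f A \<in> P" for f and A :: "nat set"
    using that
  proof (induction A rule: finite_induct)
    case (insert a A)
    have "prod f A \<in> int_adjoin z"
      using insert.hyps(1) insert.prems(1)
      by (induction A rule: finite_induct) (auto intro: int_adjoin_closed)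
    then show ?case
      using insert P_prime[of "f a" "prod f A"] by auto
  qed (use P_1 in simp)

  have residue: "x \<in> P \<or> (\<exists>i<N. x - z ^ i \<in> P)" if x: "x \<in> int_adjoin z" for x
  proof -
    have "z ^ (p ^ e) = z"
      using zN N(2) by (simp flip: q)
    then obtain w where w: "w \<in> int_adjoin z" "x ^ q = x + of_nat p * w"
      using frobenius_mod_prime[OF p _ x] q by blast
    then have "x * (x ^ N - 1) = of_nat p * w"
      by (simp add: N(2) algebra_simps)
    then have "x * (\<Prod>i<N. x - z ^ i) \<in> P"
      using p_mult[OF w(1)] power_minus_1_eq_prod_roots_of_unity[OF zN N(1) inj] by metis
    moreover have "(\<Prod>i<N. x - z ^ i) \<in> int_adjoin z"
      using power_minus_1_eq_prod_roots_of_unity[OF zN N(1) inj, of x] x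
      by (metis int_adjoin_1 int_adjoin_diff int_adjoin_power)
    ultimately have "x \<in> P \<or> (\<Prod>i<N. x - z ^ i) \<in> P"
      using P_prime x by blast
    then show ?thesis
      using prod[of "{..<N}" "\<lambda>i. x - z ^ i"] x by (auto intro: int_adjoin_closed)
  qed
  have z_unit: "z ^ k \<notin> P" for k
  proof
    assume "z ^ k \<in> P"
    then have "z ^ k * (z ^ k) ^ (N - 1) \<in> P"
      by (rule P_mult) (intro int_adjoin_closed)
    also have "z ^ k * (z ^ k) ^ (N - 1) = (z ^ k) ^ N"
      using N(1) by (simp add: power_eq_if)
    also have "\<dots> = 1"
      using zN by (metis mult.commute power_mult power_one)
    finally show False using P_1 by simp
  qed
  have distinct: "z ^ i - z ^ j \<notin> P" if ij: "i < j" "j < N" for i j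
  proof
    assume "z ^ i - z ^ j \<in> P"
    moreover define d where "d = j - i"
    have "z ^ i - z ^ j = z ^ i * (1 - z ^ d)"
      using ij by (simp add: d_def algebra_simps flip: power_add)
    ultimately have d: "1 - z ^ d \<in> P"
      using P_prime[of "z ^ i" "1 - z ^ d"] z_unit by (auto intro: int_adjoin_closed)
    have "z ^ d \<noteq> 1"
      using inj_onD[OF inj, of d 0] ij less_imp_diff_less[of j N i] by (auto simp: d_def)
    moreover have "(z ^ d) ^ N = 1"
      using zN by (metis mult.commute power_mult power_one)
    ultimately have "(\<Sum>k<N. (z ^ d) ^ k) = 0"
      using geometric_sum[of "z ^ d" N] by simp
    then have "of_nat N = (\<Sum>k<N. 1 - (z ^ d) ^ k)"
      by (simp add: sum_subtractf)
    also have "\<dots> = (\<Sum>k<N. (1 - z ^ d) * (\<Sum>l<k. (z ^ d) ^ l))"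
      by (simp add: one_diff_power_eq)
    also have "\<dots> \<in> P"
      using d by (intro P_sum P_mult int_adjoin_closed) auto
    finally have "of_nat N \<in> P" .
    moreover have "of_nat q \<in> P"
      using p_mult[of "of_nat (p ^ (e - 1))"] e
      by (simp add: q power_eq_if int_adjoin_closed split: if_splits)
    ultimately have "of_nat q - of_nat N \<in> P"
      by (rule P_diff[rotated])
    then show False
      using P_1 by (simp add: N(2))
  qed

  have coset_eq: "P +>\<^bsub>?R\<^esub> x = P +>\<^bsub>?R\<^esub> y \<longleftrightarrow> x - y \<in> P"
    if "x \<in> int_adjoin z" "y \<in> int_adjoin z" for x y
    using R.quotient_eq_iff_same_a_r_cos[OF P.is_ideal, of x y] that
    by (simp add: a_minus_def a_inv_int_adjoin_ring)
  \<comment> \<open>representatives of the residue classes; the index N stands for the zero class\<close>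
  define r where "r = (\<lambda>i. if i < N then z ^ i else 0)"
  have r: "r i \<in> int_adjoin z" for i
    by (auto simp: r_def intro: int_adjoin_closed)
  have r_eq: "i = j" if "r i - r j \<in> P" "i \<le> N" "j \<le> N" for i j
  proof (rule ccontr)
    have r_less: "r i - r j \<notin> P" if "i < j" "j \<le> N" for i j
      using that distinct[of i j] z_unit[of i] by (auto simp: r_def)
    assume "i \<noteq> j"
    then show False
      using that r_less[of i j] r_less[of j i] P_mult[of "r i - r j" "- 1"]
      by (cases "i < j") (auto simp: int_adjoin_closed)
  qed
  let ?F = "?R Quot P"
  have carrier: "carrier ?F = (\<lambda>i. P +>\<^bsub>?R\<^esub> r i) ` {..N}"
  proof
    have "carrier ?F = (\<lambda>x. P +>\<^bsub>?R\<^esub> x) ` int_adjoin z"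
      by (auto simp: FactRing_def A_RCOSETS_def')
    also have "\<dots> \<subseteq> (\<lambda>i. P +>\<^bsub>?R\<^esub> r i) ` {..N}"
    proof
      fix c assume "c \<in> (\<lambda>x. P +>\<^bsub>?R\<^esub> x) ` int_adjoin z"
      then obtain x where x: "x \<in> int_adjoin z" "c = P +>\<^bsub>?R\<^esub> x" by blast
      obtain i where "i \<le> N" "x - r i \<in> P"
        using residue[OF x(1)] by (auto simp: r_def split: if_splits)
          (metis diff_zero le_refl less_irrefl, metis less_imp_le)
      then show "c \<in> (\<lambda>i. P +>\<^bsub>?R\<^esub> r i) ` {..N}"
        using coset_eq[OF x(1) r] x(2) by blast
    qed
    finally show "carrier ?F \<subseteq> (\<lambda>i. P +>\<^bsub>?R\<^esub> r i) ` {..N}" .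
    show "(\<lambda>i. P +>\<^bsub>?R\<^esub> r i) ` {..N} \<subseteq> carrier ?F"
      using r by (auto simp: FactRing_def A_RCOSETS_def')
  qed
  moreover have "inj_on (\<lambda>i. P +>\<^bsub>?R\<^esub> r i) {..N}"
    using r_eq coset_eq[OF r r] by (auto intro!: inj_onI)
  ultimately have "card (carrier ?F) = q" "finite (carrier ?F)"
    using N(2) by (auto simp: card_image)
  moreover have "field ?F"
    by (rule P.quotient_is_field[OF R.is_cring])
  ultimately show ?thesis by blast
qed

section \<open>Homomorphisms between finite cyclic groups\<close>

text \<open>
  All fibres are translates of the kernel.
\<close>

lemma card_fibre_surj_hom:
  assumes "group_hom H G \<chi>" and surj: "\<chi> ` carrier H = carrier G" and fin: "finite (carrier H)"
    and c: "c \<in> carrier G"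
  shows "card {x \<in> carrier H. \<chi> x = c} = order H div order G"
proof -
  interpret group_hom H G \<chi> by fact
  let ?K = "\<lambda>c. {x \<in> carrier H. \<chi> x = c}"
  have card_eq: "card (?K c) = card (?K \<one>\<^bsub>G\<^esub>)" if "c \<in> carrier G" for c
  proof -
    have "c \<in> \<chi> ` carrier H"
      using surj that by simp
    then obtain a where a: "a \<in> carrier H" "\<chi> a = c"
      by blast
    have "bij_betw (\<lambda>x. a \<otimes>\<^bsub>H\<^esub> x) (?K \<one>\<^bsub>G\<^esub>) (?K c)"
      using a that by (intro bij_betwI[where g = "\<lambda>x. inv\<^bsub>H\<^esub> a \<otimes>\<^bsub>H\<^esub> x"]) (auto simp: G.m_assoc[symmetric])
    then show ?thesis
      by (rule bij_betw_same_card[symmetric])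
  qed
  have "carrier H = (\<Union>c\<in>carrier G. ?K c)"
    by auto
  moreover have "finite (carrier G)"
    using fin surj by (metis finite_imageI)
  ultimately have "order H = (\<Sum>c\<in>carrier G. card (?K c))"
    unfolding order_def using fin by (subst \<open>carrier H = _\<close>, intro card_UN_disjoint) auto
  also have "\<dots> = (\<Sum>c\<in>carrier G. card (?K \<one>\<^bsub>G\<^esub>))"
    by (intro sum.cong card_eq) simp_all
  also have "\<dots> = order G * card (?K \<one>\<^bsub>G\<^esub>)"
    by (simp add: order_def)
  finally have "order H = order G * card (?K \<one>\<^bsub>G\<^esub>)" .
  moreover have "order G > 0"
    using H.order_gt_0_iff_finite \<open>finite (carrier G)\<close> by blast
  ultimately show ?thesis
    unfolding card_eq[OF c] by simp
qed

lemma cyclic_group_nat_powers: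
  fixes G (structure)
  assumes "group G" and "cyclic_group G" and "finite (carrier G)"
  obtains g where "g \<in> carrier G" and "carrier G = {g [^] i | i :: nat. i \<in> UNIV}"
proof -
  interpret group G by fact
  obtain g where g: "g \<in> carrier G" "carrier G = range (\<lambda>n::int. g [^] n)"
    using assms(2) cyclic_group by auto
  have "carrier G \<subseteq> {g [^] i | i :: nat. i \<in> UNIV}"
  proof -
    have "generate G {g} = carrier G"
      using g generate_pow by auto
    then show ?thesis
      using generate_pow_on_finite_carrier[OF assms(3) g(1)] by auto
  qed
  then have "carrier G = {g [^] i | i :: nat. i \<in> UNIV}"
    using g(1) by auto
  with g(1) show ?thesis
    by (rule that)
qed

text \<open>
  Sending \<open>a [^] i\<close> to \<open>g [^] i\<close> for a generator \<open>g\<close> of \<open>G\<close> is well defined, since the order of \<open>g\<close>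
  divides that of \<open>a\<close>.
\<close>

lemma cyclic_group_epimorphism:
  assumes "group H" and "finite (carrier H)" and a: "a \<in> carrier H"
    and H: "carrier H = {a [^]\<^bsub>H\<^esub> i | i :: nat. i \<in> UNIV}"
    and "group G" and "cyclic_group G" and "finite (carrier G)" and dvd: "order G dvd order H"
  shows "\<exists>\<chi>. group_hom H G \<chi> \<and> \<chi> ` carrier H = carrier G"
proof -
  interpret H: group H by fact
  interpret G: group G by fact
  obtain g where g: "g \<in> carrier G" "carrier G = {g [^]\<^bsub>G\<^esub> i | i :: nat. i \<in> UNIV}"
    using cyclic_group_nat_powers assms(5-7) by blast
  have well_def: "g [^]\<^bsub>G\<^esub> i = g [^]\<^bsub>G\<^esub> j" if "a [^]\<^bsub>H\<^esub> i = a [^]\<^bsub>H\<^esub> j" for i j :: nat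
  proof -
    have "int (H.ord a) dvd int j - int i"
      using that H.int_pow_eq[OF a, of "int i" "int j"] by (simp add: int_pow_int)
    moreover have "H.ord a = order H"
      using H.generate_pow_card[OF a] H.generate_pow_on_finite_carrier[OF assms(2) a] H
      by (simp add: order_def)
    moreover have "G.ord g dvd order H"
      using G.ord_dvd_group_order[OF g(1)] dvd by (rule dvd_trans)
    ultimately have "int (G.ord g) dvd int j - int i"
      by (metis dvd_trans int_dvd_int_iff)
    then show ?thesis
      using G.int_pow_eq[OF g(1), of "int i" "int j"] by (simp add: int_pow_int)
  qed
  define \<chi> where "\<chi> = (\<lambda>x. g [^]\<^bsub>G\<^esub> (SOME i::nat. x = a [^]\<^bsub>H\<^esub> i))"
  have \<chi>: "\<chi> (a [^]\<^bsub>H\<^esub> i) = g [^]\<^bsub>G\<^esub> i" for i :: nat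
    unfolding \<chi>_def by (rule well_def) (metis (mono_tags, lifting) someI)
  have "\<chi> \<in> hom H G"
  proof (rule homI)
    fix x y assume "x \<in> carrier H" "y \<in> carrier H"
    then obtain i j :: nat where "x = a [^]\<^bsub>H\<^esub> i" "y = a [^]\<^bsub>H\<^esub> j"
      using H by auto
    then show "\<chi> x \<in> carrier G" "\<chi> (x \<otimes>\<^bsub>H\<^esub> y) = \<chi> x \<otimes>\<^bsub>G\<^esub> \<chi> y"
      using a g(1) by (simp_all add: \<chi> H.nat_pow_mult G.nat_pow_mult)
  qed
  moreover have "\<chi> ` carrier H = carrier G"
    unfolding H g(2) using \<chi> by (auto simp: image_iff) metis
  ultimately show ?thesis
    by (auto simp: group_hom_def group_hom_axioms_def assms)
qed

text \<open>
  Let \<open>H\<close> have order \<open>N = n * m\<close> and \<open>G\<close> order \<open>n\<close>, and write \<open>y = a [^] i\<close>. Then \<open>N\<close> divides \<open>2 * i\<close>.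
  The parity condition says that \<open>m\<close> is even or \<open>N\<close> is odd, and in both cases \<open>n\<close> divides \<open>i\<close>, so that \<open>y\<close>
  is mapped to an \<open>n\<close>-th power, which is \<open>\<one>\<close>. For the multiplicative group of a field of order \<open>N + 1\<close> and
  \<open>y = -1\<close>, this makes the weights below symmetric.
\<close>

lemma hom_involution_eq_one:
  assumes "group_hom H G \<chi>" and "finite (carrier H)" and "finite (carrier G)" and "a \<in> carrier H"
    and H: "carrier H = {a [^]\<^bsub>H\<^esub> i | i :: nat. i \<in> UNIV}"
    and "order G dvd order H" and "even ((order H + 1) * order H div order G)"
    and y: "y \<in> carrier H" "y \<otimes>\<^bsub>H\<^esub> y = \<one>\<^bsub>H\<^esub>"
  shows "\<chi> y = \<one>\<^bsub>G\<^esub>"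
proof -
  interpret group_hom H G \<chi> by fact
  let ?N = "order H" and ?n = "order G"
  have a: "a \<in> carrier H" by fact
  obtain i :: nat where i: "y = a [^]\<^bsub>H\<^esub> i"
    using y(1) H by auto
  have "G.ord a = ?N"
    using G.generate_pow_card[OF a] G.generate_pow_on_finite_carrier[OF assms(2) a] H
    by (simp add: order_def)
  moreover have "a [^]\<^bsub>H\<^esub> (2 * i) = \<one>\<^bsub>H\<^esub>"
    using y(2) a i by (simp add: G.nat_pow_mult mult_2)
  ultimately have dvd: "?N dvd 2 * i"
    using G.pow_eq_id[OF a] by simp
  obtain m where m: "?N = ?n * m"
    using assms(6) by blast
  have "?n > 0"
    using assms(3) H.order_gt_0_iff_finite by blast
  then have "even ((?N + 1) * m)"
    using assms(7) m by (metis mult.left_commute nonzero_mult_div_cancel_left not_gr_zero)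
  then have "?n dvd i"
  proof (cases "even m")
    case True
    then obtain t where "m = 2 * t" by blast
    then have "2 * (?n * t) dvd 2 * i"
      using dvd m by (simp add: mult.left_commute)
    then have "?n * t dvd i"
      by simp
    then show ?thesis
      by (rule dvd_mult_left)
  next
    case False
    then have "coprime ?N 2"
      using \<open>even ((?N + 1) * m)\<close> by (simp add: coprime_right_2_iff_odd)
    then have "?N dvd i"
      using dvd coprime_dvd_mult_right_iff by blast
    then show ?thesis
      using assms(6) dvd_trans by blast
  qed
  then obtain j where "i = ?n * j" by blast
  then have "\<chi> y = (\<chi> a [^]\<^bsub>G\<^esub> ?n) [^]\<^bsub>G\<^esub> j"
    using i a by (simp add: hom_nat_pow H.nat_pow_pow)
  then show ?thesis
    using a by (simp add: H.pow_order_eq_1)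
qed

section \<open>Weights on the projective line\<close>

text \<open>
  The point \<open>Some a\<close> of the projective line stands for the vector \<open>(1, a)\<close>, and \<open>None\<close> for the vector
  \<open>(0, 1)\<close>.
\<close>

definition proj_line :: "('f, 'b) ring_scheme \<Rightarrow> 'f option set" where
  "proj_line F = insert None (Some ` carrier F)"

text \<open>
  For distinct points this is \<open>\<chi>\<close> applied to the determinant of the two representing vectors, up to a
  sign that is immaterial when \<open>\<chi> (-1) = 1\<close>.
\<close>

fun det_weight :: "('f, 'b) ring_scheme \<Rightarrow> ('f \<Rightarrow> 'g) \<Rightarrow> 'f option \<Rightarrow> 'f option \<Rightarrow> 'g" where
  "det_weight F \<chi> (Some a) (Some b) = \<chi> (b \<ominus>\<^bsub>F\<^esub> a)"
| "det_weight F \<chi> _ _ = \<chi> \<one>\<^bsub>F\<^esub>"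

text \<open>
  For fixed distinct points \<open>x\<close> and \<open>y\<close>, the quotient of the determinants of \<open>x, z\<close> and \<open>y, z\<close> is, up to a
  sign, an injective function \<open>r\<close> of the remaining points \<open>z\<close>. There are as many remaining points as nonzero
  elements of the field, so \<open>r\<close> is a bijection onto these, and the \<open>z\<close> for which the weights have
  quotient \<open>c\<close> correspond to a fibre of \<open>\<chi>\<close>. The lemma is thus reduced to exhibiting \<open>r\<close> in the
  three cases, according to whether \<open>x\<close> or \<open>y\<close> is the point at infinity.
\<close>

lemma balanced_det_weight:
  fixes F (structure)
  assumes "field F" and fin: "finite (carrier F)"
    and "group_hom (mult_of F) G \<chi>" and surj: "\<chi> ` carrier (mult_of F) = carrier G"
    and neg: "\<chi> (\<ominus> \<one>) = \<one>\<^bsub>G\<^esub>"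
  shows "balanced_weighing G (proj_line F) (det_weight F \<chi>) ((order F - 1) div order G)"
proof -
  interpret F: field F by fact
  interpret \<chi>: group_hom "mult_of F" G \<chi> by fact
  let ?X = "proj_line F" and ?w = "det_weight F \<chi>" and ?\<mu> = "(order F - 1) div order G"
  have fin_X: "finite ?X" and card_X: "card ?X = order F + 1"
    using fin by (simp_all add: proj_line_def card_image order_def)
  have \<chi>_closed: "\<chi> u \<in> carrier G" if "u \<in> carrier F" "u \<noteq> \<zero>" for u
    using \<chi>.hom_closed[of u] that by simp
  have \<chi>_mult: "\<chi> (u \<otimes> v) = \<chi> u \<otimes>\<^bsub>G\<^esub> \<chi> v" if "u \<in> carrier F" "u \<noteq> \<zero>" "v \<in> carrier F" "v \<noteq> \<zero>" for u v
    using \<chi>.hom_mult[of u v] that by simp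
  have \<chi>_one: "\<chi> \<one> = \<one>\<^bsub>G\<^esub>"
    using \<chi>.hom_one by simp
  have diff_nz: "b \<ominus> a \<in> carrier F" "b \<ominus> a \<noteq> \<zero>" if "a \<in> carrier F" "b \<in> carrier F" "a \<noteq> b" for a b
    using that by auto
  have w_closed: "?w x y \<in> carrier G" if "x \<in> ?X" "y \<in> ?X" "x \<noteq> y" for x y
    using that diff_nz by (cases x; cases y) (auto simp: proj_line_def \<chi>_closed \<chi>_one)
  have w_sym: "?w x y = ?w y x" if "x \<in> ?X" "y \<in> ?X" "x \<noteq> y" for x y
  proof (cases x; cases y)
    fix a b assume ab: "x = Some a" "y = Some b"
    then have "a \<in> carrier F" "b \<in> carrier F" "a \<noteq> b"
      using that by (auto simp: proj_line_def)
    moreover from this have "b \<ominus> a = (\<ominus> \<one>) \<otimes> (a \<ominus> b)"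
      by (simp add: F.l_minus F.minus_add a_minus_def F.a_comm)
    ultimately show ?thesis
      using \<chi>_mult[of "\<ominus> \<one>" "a \<ominus> b"] diff_nz neg ab \<chi>_closed F.add.inv_eq_1_iff by auto
  qed auto
  have balanced: "card {z \<in> ?X - {x, y}. ?w x z = c \<otimes>\<^bsub>G\<^esub> ?w y z} = ?\<mu>"
    if xy: "x \<in> ?X" "y \<in> ?X" "x \<noteq> y" and c: "c \<in> carrier G"
      and r: "inj_on r (?X - {x, y})" "r ` (?X - {x, y}) \<subseteq> carrier F - {\<zero>}"
        "\<And>z. z \<in> ?X - {x, y} \<Longrightarrow> ?w x z = \<chi> (r z) \<otimes>\<^bsub>G\<^esub> ?w y z" for x y c r
  proof -
    have "card (?X - {x, y}) = card (carrier F - {\<zero>})"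
      using xy card_X fin_X fin by (simp add: card_Diff_subset order_def)
    then have r_onto: "r ` (?X - {x, y}) = carrier F - {\<zero>}"
      using r(1,2) fin by (intro card_subset_eq) (auto simp: card_image)
    have w_iff: "?w x z = c \<otimes>\<^bsub>G\<^esub> ?w y z \<longleftrightarrow> \<chi> (r z) = c" if "z \<in> ?X - {x, y}" for z
    proof -
      have "r z \<in> carrier F - {\<zero>}"
        using r(2) that by blast
      then have "?w y z \<in> carrier G" "\<chi> (r z) \<in> carrier G"
        using that xy w_closed[of y z] \<chi>_closed[of "r z"] by auto
      then show ?thesis
        unfolding r(3)[OF that] using \<chi>.H.right_cancel[of "?w y z" "\<chi> (r z)" c] c by simp
    qed
    have "{z \<in> ?X - {x, y}. ?w x z = c \<otimes>\<^bsub>G\<^esub> ?w y z} = {z \<in> ?X - {x, y}. \<chi> (r z) = c}"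
      using w_iff by blast
    moreover have "bij_betw r {z \<in> ?X - {x, y}. \<chi> (r z) = c} {u \<in> r ` (?X - {x, y}). \<chi> u = c}"
      unfolding bij_betw_def by (intro conjI inj_on_subset[OF r(1)]) blast+
    ultimately have "bij_betw r {z \<in> ?X - {x, y}. ?w x z = c \<otimes>\<^bsub>G\<^esub> ?w y z}
        {u \<in> carrier (mult_of F). \<chi> u = c}"
      by (simp only: r_onto carrier_mult_of)
    then have "card {z \<in> ?X - {x, y}. ?w x z = c \<otimes>\<^bsub>G\<^esub> ?w y z}
        = card {u \<in> carrier (mult_of F). \<chi> u = c}"
      by (rule bij_betw_same_card)
    also have "\<dots> = ?\<mu>"
      using card_fibre_surj_hom[OF assms(3) surj _ c] fin by (simp add: F.finite_mult_of F.order_mult_of)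
    finally show ?thesis .
  qed
  have diff_cancel: "u = v" if "u \<ominus> a = v \<ominus> a" "u \<in> carrier F" "v \<in> carrier F" "a \<in> carrier F" for u v a
    using that by (simp add: a_minus_def)
  have inv: "inv u \<in> carrier F" "inv u \<noteq> \<zero>" "inv u \<otimes> u = \<one>" "inv (inv u) = u"
    if "u \<in> carrier F" "u \<noteq> \<zero>" for u
  proof -
    have u: "u \<in> Units F"
      using that by (simp add: F.field_Units)
    then show "inv u \<in> carrier F" "inv u \<otimes> u = \<one>" "inv (inv u) = u"
      by simp_all
    show "inv u \<noteq> \<zero>"
      using F.Units_inv_Units[OF u] by (simp add: F.field_Units)
  qed
  have ratio: "(\<one> \<oplus> (b \<ominus> a) \<otimes> inv (d \<ominus> b)) \<otimes> (d \<ominus> b) = d \<ominus> a"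
    if "a \<in> carrier F" "b \<in> carrier F" "d \<in> carrier F" "d \<noteq> b" for a b d
  proof -
    have "(\<one> \<oplus> (b \<ominus> a) \<otimes> inv (d \<ominus> b)) \<otimes> (d \<ominus> b)
        = (d \<ominus> b) \<oplus> (b \<ominus> a) \<otimes> (inv (d \<ominus> b) \<otimes> (d \<ominus> b))"
      using that inv(1)[of "d \<ominus> b"] diff_nz[of b d] by (simp add: F.l_distr F.m_assoc)
    also have "\<dots> = (d \<ominus> b) \<oplus> (b \<ominus> a)"
      using that inv(3)[of "d \<ominus> b"] diff_nz[of b d] by simp
    also have "\<dots> = d \<ominus> a"
      using that by algebra
    finally show ?thesis .
  qed
  show ?thesis
    unfolding balanced_weighing_def
  proof (intro ballI impI conjI)
    fix x y assume xy: "x \<in> ?X" "y \<in> ?X" "x \<noteq> y"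
    show "?w x y \<in> carrier G" "?w x y = ?w y x"
      using w_closed w_sym xy by blast+
    fix c assume c: "c \<in> carrier G"
    note bal = balanced[OF xy c]
    consider b where "x = None" "y = Some b" "b \<in> carrier F"
      | a where "x = Some a" "y = None" "a \<in> carrier F"
      | a b where "x = Some a" "y = Some b" "a \<in> carrier F" "b \<in> carrier F" "a \<noteq> b"
      using xy by (auto simp: proj_line_def)
    then show "card {z \<in> ?X - {x, y}. ?w x z = c \<otimes>\<^bsub>G\<^esub> ?w y z} = ?\<mu>"
    proof cases
      case 1
      let ?r = "\<lambda>z. inv (the z \<ominus> b)"
      have z: "\<exists>d. z = Some d \<and> d \<in> carrier F \<and> d \<noteq> b" if "z \<in> ?X - {x, y}" for z
        using that 1 by (auto simp: proj_line_def)
      show ?thesis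
      proof (rule bal[of ?r])
        show "inj_on ?r (?X - {x, y})"
        proof (rule inj_onI)
          fix u v assume u: "u \<in> ?X - {x, y}" and v: "v \<in> ?X - {x, y}" and eq: "?r u = ?r v"
          obtain d where d: "u = Some d" "d \<in> carrier F" "d \<noteq> b"
            using z[OF u] by blast
          obtain d' where d': "v = Some d'" "d' \<in> carrier F" "d' \<noteq> b"
            using z[OF v] by blast
          have "d \<ominus> b = inv (inv (d \<ominus> b))"
            by (rule inv(4)[symmetric]) (use d 1(3) diff_nz in auto)
          also have "\<dots> = inv (inv (d' \<ominus> b))"
            using eq d(1) d'(1) by simp
          also have "\<dots> = d' \<ominus> b"
            by (rule inv(4)) (use d' 1(3) diff_nz in auto)
          finally show "u = v"
            using diff_cancel[of d b d'] d d' 1(3) by simp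
        qed
        show "?r ` (?X - {x, y}) \<subseteq> carrier F - {\<zero>}"
        proof (rule image_subsetI)
          fix z assume "z \<in> ?X - {x, y}"
          then obtain d where "z = Some d" "d \<in> carrier F" "d \<noteq> b"
            using z by blast
          then show "?r z \<in> carrier F - {\<zero>}"
            using inv(1,2)[of "d \<ominus> b"] diff_nz[of b d] 1(3) by simp
        qed
        show "?w x z = \<chi> (?r z) \<otimes>\<^bsub>G\<^esub> ?w y z" if "z \<in> ?X - {x, y}" for z
        proof -
          obtain d where d: "z = Some d" "d \<in> carrier F" "d \<noteq> b"
            using z \<open>z \<in> ?X - {x, y}\<close> by blast
          then show ?thesis
            using 1 inv[of "d \<ominus> b"] diff_nz[of b d] \<chi>_mult[of "inv (d \<ominus> b)" "d \<ominus> b"] by simp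
        qed
      qed
    next
      case 2
      let ?r = "\<lambda>z. the z \<ominus> a"
      have z: "\<exists>d. z = Some d \<and> d \<in> carrier F \<and> d \<noteq> a" if "z \<in> ?X - {x, y}" for z
        using that 2 by (auto simp: proj_line_def)
      show ?thesis
      proof (rule bal[of ?r])
        show "inj_on ?r (?X - {x, y})"
        proof (rule inj_onI)
          fix u v assume u: "u \<in> ?X - {x, y}" and v: "v \<in> ?X - {x, y}" and eq: "?r u = ?r v"
          obtain d where "u = Some d" "d \<in> carrier F"
            using z[OF u] by blast
          moreover obtain d' where "v = Some d'" "d' \<in> carrier F"
            using z[OF v] by blast
          ultimately show "u = v"
            using diff_cancel[of d a d'] eq 2(3) by simp
        qed
        show "?r ` (?X - {x, y}) \<subseteq> carrier F - {\<zero>}"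
        proof (rule image_subsetI)
          fix z assume "z \<in> ?X - {x, y}"
          then obtain d where "z = Some d" "d \<in> carrier F" "d \<noteq> a"
            using z by blast
          then show "?r z \<in> carrier F - {\<zero>}"
            using diff_nz[of a d] 2(3) by simp
        qed
        show "?w x z = \<chi> (?r z) \<otimes>\<^bsub>G\<^esub> ?w y z" if "z \<in> ?X - {x, y}" for z
        proof -
          obtain d where d: "z = Some d" "d \<in> carrier F" "d \<noteq> a"
            using z \<open>z \<in> ?X - {x, y}\<close> by blast
          then show ?thesis
            using 2 diff_nz[of a d] \<chi>_closed[of "d \<ominus> a"] \<chi>_one by simp
        qed
      qed
    next
      case 3
      \<comment> \<open>this is (d - a) / (d - b), written so that its dependence on d is visibly injective;
        the value 1, which it omits, is taken at infinity\<close>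
      let ?s = "\<lambda>d. \<one> \<oplus> (b \<ominus> a) \<otimes> inv (d \<ominus> b)"
      let ?r = "case_option \<one> ?s"
      have z: "z = None \<or> (\<exists>d. z = Some d \<and> d \<in> carrier F \<and> d \<noteq> a \<and> d \<noteq> b)"
        if "z \<in> ?X - {x, y}" for z
        using that 3 by (auto simp: proj_line_def)
      have s_nz: "?s d \<in> carrier F" "?s d \<noteq> \<zero>" if d: "d \<in> carrier F" "d \<noteq> a" "d \<noteq> b" for d
      proof -
        show s: "?s d \<in> carrier F"
          using 3 d inv(1)[of "d \<ominus> b"] diff_nz[of b d] by simp
        show "?s d \<noteq> \<zero>"
        proof
          assume "?s d = \<zero>"
          then have "d \<ominus> a = \<zero>"
            using ratio[of a b d] 3 d diff_nz(1)[of b d] by (metis F.l_null)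
          then show False
            using diff_nz(2)[of a d] 3 d by simp
        qed
      qed
      have e_inv: "(b \<ominus> a) \<otimes> inv (d \<ominus> b) \<in> carrier F" if "d \<in> carrier F" "d \<noteq> b" for d
        using 3 that inv(1)[of "d \<ominus> b"] diff_nz[of b d] by simp
      have s_one: "?s d \<noteq> \<one>" if d: "d \<in> carrier F" "d \<noteq> b" for d
      proof
        assume "?s d = \<one>"
        then have "(b \<ominus> a) \<otimes> inv (d \<ominus> b) = \<zero>"
          using F.add.l_cancel_one[of \<one> "(b \<ominus> a) \<otimes> inv (d \<ominus> b)"] e_inv[OF d] by simp
        then show False
          using 3 d inv[of "d \<ominus> b"] diff_nz[of b d] diff_nz[of a b] F.integral_iff by auto
      qed
      have s_inj: "d = d'" if eq: "?s d = ?s d'" and d: "d \<in> carrier F" "d \<noteq> b"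
        "d' \<in> carrier F" "d' \<noteq> b" for d d'
      proof -
        have "(b \<ominus> a) \<otimes> inv (d \<ominus> b) = (b \<ominus> a) \<otimes> inv (d' \<ominus> b)"
          using eq e_inv d by simp
        then have "inv (d \<ominus> b) = inv (d' \<ominus> b)"
          using F.m_lcancel[of "b \<ominus> a"] 3 d inv(1) diff_nz by simp
        then have "inv (inv (d \<ominus> b)) = inv (inv (d' \<ominus> b))"
          by (rule arg_cong)
        moreover have "inv (inv (d \<ominus> b)) = d \<ominus> b"
          by (rule inv(4)) (use d 3 diff_nz in auto)
        moreover have "inv (inv (d' \<ominus> b)) = d' \<ominus> b"
          by (rule inv(4)) (use d 3 diff_nz in auto)
        ultimately show ?thesis
          using diff_cancel[of d b d'] d 3 by simp
      qed
      show ?thesis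
      proof (rule bal[of ?r])
        show "inj_on ?r (?X - {x, y})"
        proof (rule inj_onI)
          fix u v assume u: "u \<in> ?X - {x, y}" and v: "v \<in> ?X - {x, y}" and eq: "?r u = ?r v"
          show "u = v"
            using z[OF u] z[OF v]
          proof (elim disjE exE conjE)
            fix d assume d: "u = None" "v = Some d" "d \<in> carrier F" "d \<noteq> b"
            then show ?thesis
              using eq s_one[OF d(3,4)] by (simp only: option.case) metis
          next
            fix d assume d: "u = Some d" "d \<in> carrier F" "d \<noteq> b" "v = None"
            then show ?thesis
              using eq s_one[OF d(2,3)] by (simp only: option.case)
          next
            fix d d' assume d: "u = Some d" "d \<in> carrier F" "d \<noteq> b"
              "v = Some d'" "d' \<in> carrier F" "d' \<noteq> b"
            then show ?thesis
              using eq s_inj[OF _ d(2,3,5,6)] by (simp only: option.case)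
          qed simp
        qed
        show "?r ` (?X - {x, y}) \<subseteq> carrier F - {\<zero>}"
        proof (rule image_subsetI)
          fix u assume "u \<in> ?X - {x, y}"
          then show "?r u \<in> carrier F - {\<zero>}"
            using z[of u] s_nz by auto
        qed
        show "?w x z = \<chi> (?r z) \<otimes>\<^bsub>G\<^esub> ?w y z" if "z \<in> ?X - {x, y}" for z
          using z[OF that]
        proof (elim disjE exE conjE)
          assume "z = None"
          then show ?thesis
            using 3 \<chi>_one by simp
        next
          fix d assume d: "z = Some d" "d \<in> carrier F" "d \<noteq> a" "d \<noteq> b"
          then show ?thesis
            using 3 ratio[of a b d] s_nz[of d] \<chi>_mult[of "?s d" "d \<ominus> b"] diff_nz[of b d] by simp
        qed
      qed
    qed
  qed
qed

section \<open>The graph of a cyclic difference set\<close>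

theorem theorem1p2:
  fixes q n k l :: nat
    and G :: "('a, 'b) monoid_scheme"
    and D :: "'a set"
  assumes "primepow q"
    and "n \<ge> 1"
    and "n dvd q - 1"
    and "even (q * (q - 1) div n)"
    and "group G"
    and "cyclic_group G"
    and "order G = n"
    and "difference_set G D n k l"
  shows "\<exists>\<Gamma> :: nat pair_pre_digraph.
           divisible_design_graph \<Gamma> (n * (q + 1)) (k * q) (l * q) (k\<^sup>2 * (q - 1) div n) (q + 1) n"
proof -
  interpret comm_group G
    using group.cyclic_imp_abelian_group[OF assms(5,6)] .
  have fin_G: "finite (carrier G)"
    using assms(8) by (simp add: difference_set_def)
  have q: "q \<ge> 2"
    using primepow_gt_Suc_0[OF assms(1)] by simp
  obtain F :: "complex set ring" where "field F" and fin: "finite (carrier F)"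
    and card_F: "card (carrier F) = q"
    using finite_field_exists[OF assms(1)] by blast
  interpret F: field F by fact
  let ?H = "mult_of F"
  have fin_H: "finite (carrier ?H)" and order_H: "order ?H = q - 1"
    using fin card_F by (simp_all add: F.finite_mult_of F.order_mult_of order_def)
  have "order G dvd order ?H"
    using assms(3,7) order_H by simp
  obtain a where a: "a \<in> carrier ?H" "carrier ?H = {a [^]\<^bsub>F\<^esub> i | i :: nat. i \<in> UNIV}"
    using F.finite_field_mult_group_has_gen[OF fin] by blast
  then have gen: "carrier ?H = {a [^]\<^bsub>?H\<^esub> i | i :: nat. i \<in> UNIV}"
    by (simp only: nat_pow_mult_of)
  obtain \<chi> where \<chi>: "group_hom ?H G \<chi>" "\<chi> ` carrier ?H = carrier G"
    using cyclic_group_epimorphism[OF F.field_mult_group fin_H a(1) gen assms(5,6) fin_G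
        \<open>order G dvd order ?H\<close>] by blast
  have "\<chi> (\<ominus>\<^bsub>F\<^esub> \<one>\<^bsub>F\<^esub>) = \<one>\<^bsub>G\<^esub>"
  proof (rule hom_involution_eq_one[OF \<chi>(1) fin_H fin_G a(1) gen \<open>order G dvd order ?H\<close>])
    show "even ((order ?H + 1) * order ?H div order G)"
      using assms(4,7) order_H q by simp
    have "\<ominus>\<^bsub>F\<^esub> \<one>\<^bsub>F\<^esub> \<noteq> \<zero>\<^bsub>F\<^esub>"
      using F.one_not_zero by (metis F.minus_minus F.minus_zero F.one_closed)
    then show "\<ominus>\<^bsub>F\<^esub> \<one>\<^bsub>F\<^esub> \<in> carrier ?H"
      by simp
    show "\<ominus>\<^bsub>F\<^esub> \<one>\<^bsub>F\<^esub> \<otimes>\<^bsub>?H\<^esub> \<ominus>\<^bsub>F\<^esub> \<one>\<^bsub>F\<^esub> = \<one>\<^bsub>?H\<^esub>"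
      by (simp add: F.l_minus)
  qed
  then have w: "balanced_weighing G (proj_line F) (det_weight F \<chi>) ((q - 1) div n)"
    using balanced_det_weight[OF \<open>field F\<close> fin \<chi>] card_F assms(7) by (simp add: order_def)
  have X: "finite (proj_line F)" "card (proj_line F) = q + 1"
    using fin card_F by (simp_all add: proj_line_def card_image)
  have "k\<^sup>2 * ((q - 1) div n) = k\<^sup>2 * (q - 1) div n"
    using assms(3) by (rule div_mult_swap)
  then have "divisible_design_graph (weighing_graph G (proj_line F) (det_weight F \<chi>) D)
      (n * (q + 1)) (k * q) (l * q) (k\<^sup>2 * (q - 1) div n) (q + 1) n"
    using divisible_design_weighing_graph[OF X(1) w assms(8)] X(2) by simp
  then show ?thesis
    by (rule divisible_design_graph_on_nat)
qed

end
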